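(* Let $(X,d)$ be a metric space, let $C\in[1,\infty)$, and suppose that there are two points $u$ and $v$ in $X$ and a nonempty family of $Cuv$-geodesics, called marked, such that the following conditions are satisfied. 1. There is a constant $c>0$ such that any marked $Cuv$-geodesic $w_0=u,w_1,\dots,w_{n-1},w_n=v$ has two different marked extensions $$z_0=u,z_1,\dots,z_m=v\qquad\text{and}\qquad \widetilde z_0=u,\widetilde z_1,\dots,\widetilde z_m=v$$ such that every sequence $z_0',z_1',\dots,z_m'$, in which each $z_i'$ is either $z_i$ or $\widetilde z_i$, is also a marked $Cuv$-geodesic. Furthermore, these extensions satisfy the following: (a) They have some more common points in addition to $w_0,w_1,\dots,w_n$; all common points have the same indices in both sequences, and, denoting by $I$ the set of indices $i$ with $z_i=\widetilde z_i$, the common points $\{z_i\}_{i\in I}$ (in increasing order of indices; this sequence contains $w_0,\dots,w_n$ as a subsequence) form a marked $Cuv$-geodesic. (b) They have some pairs of distinct points; denoting by $J$ the set of indices $i$ with $z_i\ne\widetilde z_i$, the pairs $\{z_i,\widetilde z_i\}_{i\in J}$ satisfy: - each pair of distinct points is between two pairs of common points, i.e. $i-1,i+1\in I$ for every $i\in J$; - for every $i\in J$, $$\frac{d(z_i,z_{i-1})}{d(z_i,z_{i+1})}=\frac{d(\widetilde z_i,z_{i-1})}{d(\widetilde z_i,z_{i+1})};$$ - $\sum_{i\in J}d(z_i,\widetilde z_i)\ge c\,d(u,v)$, where $c$ does not depend on the choice of the marked $Cuv$-geodesic $w_0,\dots,w_n$. 2. There exists a constant $B\in[1,\infty)$ such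 that for every finite sequence of marked $Cuv$-geodesics, in which each next one is an extension of the previous one, the final partition $0=\alpha_0,\alpha_1,\dots,\alpha_N=1$ in the corresponding nested sequence of partitions of $[0,1]$ (obtained by successive refinement) is $B$-equivalent to the partition $0=\beta_0,\beta_1,\dots,\beta_N=1$ corresponding to the last geodesic of the sequence, that is, $$\frac1B\le\frac{\alpha_{i+1}-\alpha_i}{\beta_{i+1}-\beta_i}\le B\qquad\text{for all } i=0,\dots,N-1.$$ Then the metric space $(X,d)$ does not admit a bilipschitz embedding into any Banach space with the Radon-Nikodým property.
   Context: $Cuv$-geodesics. For $C\in[1,\infty)$ and points $u,v$ of a metric space, a $Cuv$-geodesic is a finite sequence $u_0=u,u_1,\dots,u_n=v$ of points with $\sum_{i=1}^n d(u_i,u_{i-1})\le C\,d(u,v)$. A $Cuv$-geodesic $v_0,\dots,v_m$ is an extension of a $Cuv$-geodesic $u_0,\dots,u_n$ if $m\ge n$ and $u_0,\dots,u_n$ is a subsequence of $v_0,\dots,v_m$. Consecutive points of the $Cuv$-geodesics considered are understood to be distinct, so that all ratios below make sense. Partition corresponding to a $Cuv$-geodesic $u_0,\dots,u_n$: the partition of $[0,1]$ with division points $\alpha_0=0$ and $$\alpha_k=\frac{\sum_{i=1}^k d(u_i,u_{i-1})}{\sum_{i=1}^n d(u_i,u_{i-1})},\quad k=1,\dots,n.$$ Nested partitions corresponding to a sequence of $Cuv$-geodesics, each an extension of the previous one: the first partition is the partition corresponding to the first geodesic. Given the partition obtained for one geodesic $w_0,\dots,w_n$ of the sequence, with division points $\alpha_0,\dots,\alpha_n$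 (so $\alpha_i$ is associated with $w_i$), the partition for the next geodesic is the following refinement: for each $i$, if $z_j=w_i,z_{j+1},\dots,z_k=w_{i+1}$ are the points of the next geodesic from $w_i$ to $w_{i+1}$, the interval $[\alpha_i,\alpha_{i+1}]$ is divided by the points $$\alpha_i+\frac{(\alpha_{i+1}-\alpha_i)\sum_{t=j}^{s}d(z_t,z_{t+1})}{\sum_{t=j}^{k-1}d(z_t,z_{t+1})},\qquad s=j,\dots,k-2.$$ Bilipschitz embedding: a map $f:X\to Y$ into a Banach space $Y$ for which there are constants $0<\ell\le L<\infty$ with $\ell\, d(x,y)\le \|f(x)-f(y)\|\le L\, d(x,y)$ for all $x,y\in X$. A Banach space $Y$ has the Radon-Nikodým property if every $Y$-valued countably additive measure of bounded variation that is absolutely continuous with respect to a finite positive measure $\mu$ has a Bochner-integrable density with respect to $\mu$. (By Chatterji's theorem this is equivalent to almost everywhere norm convergence of every uniformly bounded $Y$-valued martingale on $[0,1]$.) *)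

theory Defs
  imports "HOL-Analysis.Analysis" "HOL-Library.Sublist"
begin

section \<open>Geodesics\<close>

definition chain_length :: "'a::metric_space list \<Rightarrow> real" where
  "chain_length w = (\<Sum>i = 1..<length w. dist (w ! i) (w ! (i - 1)))"

definition cuv_geodesic :: "real \<Rightarrow> 'a::metric_space \<Rightarrow> 'a \<Rightarrow> 'a list \<Rightarrow> bool" where
  "cuv_geodesic C u v w \<longleftrightarrow>
     w \<noteq> [] \<and> hd w = u \<and> last w = v \<and> distinct_adj w \<and> chain_length w \<le> C * dist u v"

text \<open>The second argument is the extension of the first.  The condition on the lengths is
  implied by that on subsequences.\<close>

definition cuv_extension ::
    "real \<Rightarrow> 'a::metric_space \<Rightarrow> 'a \<Rightarrow> 'a list \<Rightarrow> 'a list \<Rightarrow> bool" where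
  "cuv_extension C u v w z \<longleftrightarrow> cuv_geodesic C u v w \<and> cuv_geodesic C u v z \<and> subseq w z"


section \<open>Partitions\<close>

text \<open>A partition of the unit interval is given by the list of its division points, the
  end points 0 and 1 included.\<close>

definition geodesic_partition :: "'a::metric_space list \<Rightarrow> real list" where
  "geodesic_partition w =
     map (\<lambda>k. (\<Sum>i = 1..k. dist (w ! i) (w ! (i - 1))) / chain_length w) [0..<length w]"

definition index_embedding :: "'a list \<Rightarrow> 'a list \<Rightarrow> (nat \<Rightarrow> nat) \<Rightarrow> bool" where
  "index_embedding w z h \<longleftrightarrow>
     strict_mono_on {..<length w} h \<and> h 0 = 0 \<and> h (length w - 1) = length z - 1 \<and>
     (\<forall>i < length w. z ! h i = w ! i)"

text \<open>The division points of the refinement are indexed by the points of the extension: the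
  point \<open>\<gamma> ! s\<close> is associated with \<open>z ! s\<close>.  For \<open>s = h i\<close> and \<open>s = h (Suc i)\<close> the formula
  returns the old division points \<open>\<alpha> ! i\<close> and \<open>\<alpha> ! Suc i\<close>.  If a list visits a point several
  times, there may be several index embeddings; any of them may be used.\<close>

definition partition_refinement ::
    "'a::metric_space list \<Rightarrow> real list \<Rightarrow> 'a list \<Rightarrow> real list \<Rightarrow> bool" where
  "partition_refinement w \<alpha> z \<gamma> \<longleftrightarrow>
     length \<gamma> = length z \<and>
     (\<exists>h. index_embedding w z h \<and>
        (\<forall>i. Suc i < length w \<longrightarrow> (\<forall>s \<in> {h i..h (Suc i)}.
           \<gamma> ! s = \<alpha> ! i + (\<alpha> ! Suc i - \<alpha> ! i) * (\<Sum>t = h i..<s. dist (z ! t) (z ! Suc t))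
                               / (\<Sum>t = h i..<h (Suc i). dist (z ! t) (z ! Suc t)))))"

text \<open>\<open>nested_partition ws \<alpha>\<close>: the partition \<open>\<alpha>\<close> is the final one in the nested sequence of
  partitions corresponding to the sequence \<open>ws\<close> of geodesics.\<close>

inductive nested_partition :: "'a::metric_space list list \<Rightarrow> real list \<Rightarrow> bool" where
  first: "nested_partition [w] (geodesic_partition w)"
| step: "nested_partition ws \<alpha> \<Longrightarrow> partition_refinement (last ws) \<alpha> z \<gamma>
           \<Longrightarrow> nested_partition (ws @ [z]) \<gamma>"

definition partition_equivalent :: "real \<Rightarrow> real list \<Rightarrow> real list \<Rightarrow> bool" where
  "partition_equivalent B \<alpha> \<beta> \<longleftrightarrow> length \<alpha> = length \<beta> \<and>
     (\<forall>i. Suc i < length \<alpha> \<longrightarrow>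
        1 / B \<le> (\<alpha> ! Suc i - \<alpha> ! i) / (\<beta> ! Suc i - \<beta> ! i) \<and>
        (\<alpha> ! Suc i - \<alpha> ! i) / (\<beta> ! Suc i - \<beta> ! i) \<le> B)"


section \<open>Pairs of extensions\<close>

definition common_indices :: "'a list \<Rightarrow> 'a list \<Rightarrow> nat set" where
  "common_indices z z' = {i. i < length z \<and> i < length z' \<and> z ! i = z' ! i}"

definition distinct_indices :: "'a list \<Rightarrow> 'a list \<Rightarrow> nat set" where
  "distinct_indices z z' = {i. i < length z \<and> i < length z' \<and> z ! i \<noteq> z' ! i}"

definition common_points :: "'a list \<Rightarrow> 'a list \<Rightarrow> 'a list" where
  "common_points z z' = nths z (common_indices z z')"


section \<open>Bilipschitz embeddings\<close>

definition bilipschitz_embedding :: "('a::metric_space \<Rightarrow> 'b::real_normed_vector) \<Rightarrow> bool" where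
  "bilipschitz_embedding f \<longleftrightarrow>
     (\<exists>l L. 0 < l \<and> l \<le> L \<and>
        (\<forall>x y. l * dist x y \<le> norm (f x - f y) \<and> norm (f x - f y) \<le> L * dist x y))"


section \<open>The Radon-Nikodym property\<close>

text \<open>The Bochner integral of the library, \<open>has_bochner_integral\<close>, is restricted to second
  countable, i.e. separable, spaces.  The following definition covers all Banach spaces; it
  uses the library's integral of simple functions.  The almost everywhere convergence of the
  simple functions amounts to strong measurability of \<open>f\<close>.\<close>

definition bochner_integral_of ::
    "'m measure \<Rightarrow> ('m \<Rightarrow> 'b::banach) \<Rightarrow> 'b \<Rightarrow> bool" where
  "bochner_integral_of M f x \<longleftrightarrow>
     (\<exists>s. (\<forall>n. Bochner_Integration.simple_bochner_integrable M (s n)) \<and>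
          (AE t in M. (\<lambda>n. s n t) \<longlonglongrightarrow> f t) \<and>
          (\<lambda>n. \<integral>\<^sup>+ t. ennreal (norm (f t - s n t)) \<partial>M) \<longlonglongrightarrow> 0 \<and>
          (\<lambda>n. Bochner_Integration.simple_bochner_integral M (s n)) \<longlonglongrightarrow> x)"

definition vector_measure :: "'m measure \<Rightarrow> ('m set \<Rightarrow> 'b::banach) \<Rightarrow> bool" where
  "vector_measure M \<nu> \<longleftrightarrow>
     (\<forall>A :: nat \<Rightarrow> 'm set. range A \<subseteq> sets M \<longrightarrow> disjoint_family A \<longrightarrow>
        (\<lambda>n. \<nu> (A n)) sums \<nu> (\<Union>n. A n))"

definition bounded_variation :: "'m measure \<Rightarrow> ('m set \<Rightarrow> 'b::banach) \<Rightarrow> bool" where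
  "bounded_variation M \<nu> \<longleftrightarrow>
     (\<exists>K. \<forall>P. finite P \<longrightarrow> P \<subseteq> sets M \<longrightarrow> disjoint P \<longrightarrow> (\<Sum>A\<in>P. norm (\<nu> A)) \<le> K)"

definition vanishes_on_null_sets :: "'m measure \<Rightarrow> ('m set \<Rightarrow> 'b::banach) \<Rightarrow> bool" where
  "vanishes_on_null_sets M \<nu> \<longleftrightarrow> (\<forall>A \<in> null_sets M. \<nu> A = 0)"

text \<open>A definition cannot quantify over the type of the points of the underlying measure space.
  We let \<open>M\<close> range over all finite measures on arbitrary sigma-algebras of subsets of arbitrary
  sets of real numbers.  This is implied by the property for all finite measure spaces, and it
  is well known to be equivalent to it, since Lebesgue measure on the unit interval suffices.\<close>

definition radon_nikodym_property :: "'b::banach itself \<Rightarrow> bool" where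
  "radon_nikodym_property (TYPE('b)) \<longleftrightarrow>
     (\<forall>(M :: real measure) (\<nu> :: real set \<Rightarrow> 'b).
        finite_measure M \<longrightarrow> vector_measure M \<nu> \<longrightarrow> bounded_variation M \<nu> \<longrightarrow>
        vanishes_on_null_sets M \<nu> \<longrightarrow>
        (\<exists>f. \<forall>A \<in> sets M. bochner_integral_of M (\<lambda>t. indicator A t *\<^sub>R f t) (\<nu> A)))"

end

theory Submission
  imports Defs
begin

text \<open>Let \<open>f\<close> be a bilipschitz embedding.  Along a sequence of marked geodesics with their nested
  partitions, the slopes of \<open>f\<close> over the intervals of the partitions form a martingale, which
  condition 2 makes uniformly bounded.  Hence it is the sequence of averages of a vector measure
  dominated by a multiple of Lebesgue measure.  If the measure has a density, the density is close
  in the mean to a function constant on the intervals of some partition, so the mean deviation of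
  \<open>f\<close> from its chords over that partition is small.  On the other hand, condition 1 allows one to
  pass from the common points of two extensions to an extension that contains, for every pair of
  distinct points, the point of the pair at which \<open>f\<close> is farther from the chord; then the mean
  deviation stays bounded below.\<close>

section \<open>Simple functions and vector measures\<close>

text \<open>The density may take values in a nonseparable space, so it is replaced at once by a
  simple function. The error is kept as a scalar function \<open>h\<close> with small integral, and
  not as a number, because errors over disjoint cells have to be added. Chords fit this scheme: the
  deviation from a chord annihilates affine functions, so the constant value near which the density
  stays on a cell drops out and only integrals of \<open>h\<close> remain.

  Parameters come from the nested partitions and not from the arc length of each single geodesic,
  because only then do old division points keep both their position and their value under
  \<open>f\<close>. The price is that parameter increments must be compared with distances, and this
  is where condition 2 enters.

  One level consists of two extensions. The mixture \<open>y\<close> that deviates from the chords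
  need not be the common part of a fork, so the construction cannot go on from \<open>y\<close>
  itself; the common points of a fork over \<open>y\<close> form the next level, and they retain the
  points of \<open>y\<close> with their parameters.\<close>

lemma algebra_dense_in_sigma_sets:
  assumes "finite_measure M" and alg: "algebra (space M) G"
    and sets: "sets M = sigma_sets (space M) G"
    and A: "A \<in> sets M" and "0 < e"
  shows "\<exists>B\<in>G. measure M (sym_diff A B) < e"
proof -
  interpret finite_measure M by fact
  interpret G: algebra "space M" G by (rule alg)
  have Gs: "B \<in> sets M" if "B \<in> G" for B
    using that sets by auto
  from A have "A \<in> sigma_sets (space M) G"
    using sets by simp
  \<comment> \<open>The sets that can be approximated from \<open>G\<close> form a sigma-algebra:
    complements have the same symmetric difference, and a countable union is first cut to a finite
    one. Measurability is part of the claim since the estimates in the inductive cases rely on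
    it.\<close>
  then have "A \<in> sets M \<and> (\<forall>e>0. \<exists>B\<in>G. measure M (sym_diff A B) < e)"
  proof induction
    case (Basic a)
    then show ?case by (auto intro!: Gs bexI[of _ a])
  next
    case Empty
    then show ?case by (auto intro!: bexI[of _ "{}"])
  next
    case (Compl a)
    show ?case
    proof (intro conjI allI impI)
      show "space M - a \<in> sets M" using Compl by auto
      fix e :: real assume "0 < e"
      then obtain B where B: "B \<in> G" "measure M (sym_diff a B) < e"
        using Compl by blast
      have "sym_diff (space M - a) (space M - B) = sym_diff a B"
        using sets.sets_into_space[of a M] sets.sets_into_space[OF Gs[OF B(1)]] Compl by auto
      then show "\<exists>B\<in>G. measure M (sym_diff (space M - a) B) < e"
        using B by (intro bexI[of _ "space M - B"]) auto
    qed
  next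
    case (Union a)
    have a: "a i \<in> sets M" for i using Union by auto
    show ?case
    proof (intro conjI allI impI)
      show U: "\<Union>(range a) \<in> sets M" using a by auto
      fix e :: real assume e: "0 < e"
      define V where "V n = (\<Union>i<n. a i)" for n
      have V: "V n \<in> sets M" for n unfolding V_def using a by auto
      have "(\<lambda>n. measure M (V n)) \<longlonglongrightarrow> measure M (\<Union>n. V n)"
        using V by (intro finite_Lim_measure_incseq)
          (auto simp: incseq_def V_def intro: UN_mono[THEN subsetD])
      moreover have "(\<Union>n. V n) = \<Union>(range a)" unfolding V_def by auto
      ultimately have "(\<lambda>n. measure M (V n)) \<longlonglongrightarrow> measure M (\<Union>(range a))" by simp
      then have "eventually (\<lambda>n. measure M (\<Union>(range a)) - e / 2 < measure M (V n)) sequentially"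
        using e by (intro order_tendstoD) auto
      then obtain n where n: "measure M (\<Union>(range a)) - e / 2 < measure M (V n)"
        by (auto simp: eventually_sequentially)
      have VU: "V n \<subseteq> \<Union>(range a)" unfolding V_def by auto
      have 1: "measure M (\<Union>(range a) - V n) < e / 2"
        using n finite_measure_Diff[OF U V VU] by simp
      \<comment> \<open>Half of \<open>e\<close> was spent on cutting the union; the other half is
        shared by \<open>n\<close> sets, with \<open>n + 1\<close> in the denominator so that
        \<open>n = 0\<close> is allowed.\<close>
      have "\<exists>B. B \<in> G \<and> measure M (sym_diff (a i) B) < e / (2 * (real n + 1))" for i
        using Union e by (auto simp: Bex_def)
      then obtain B where B: "\<And>i. B i \<in> G"
        "\<And>i. measure M (sym_diff (a i) (B i)) < e / (2 * (real n + 1))"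
        by metis
      let ?B = "\<Union>i<n. B i"
      have BG: "?B \<in> G" using B by auto
      have sd: "sym_diff (a i) (B i) \<in> sets M" for i using a Gs[OF B(1)] by auto
      have "measure M (sym_diff (\<Union>(range a)) ?B) \<le>
          measure M ((\<Union>(range a) - V n) \<union> (\<Union>i<n. sym_diff (a i) (B i)))"
        using U V sd by (intro finite_measure_mono) (auto simp: V_def)
      also have "\<dots> \<le> measure M (\<Union>(range a) - V n) + measure M (\<Union>i<n. sym_diff (a i) (B i))"
        using U V sd by (intro measure_Un_le) auto
      also have "measure M (\<Union>i<n. sym_diff (a i) (B i)) \<le> (\<Sum>i<n. measure M (sym_diff (a i) (B i)))"
        using sd by (intro finite_measure_subadditive_finite) auto
      also have "\<dots> \<le> (\<Sum>i<n. e / (2 * (real n + 1)))"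
        using B by (intro sum_mono) (auto intro: less_imp_le)
      also have "\<dots> \<le> e / 2"
        using e by (simp add: field_simps)
      finally have "measure M (sym_diff (\<Union>(range a)) ?B) < e" using 1 by simp
      then show "\<exists>B\<in>G. measure M (sym_diff (\<Union>(range a)) B) < e" using BG by blast
    qed
  qed
  then show ?thesis using \<open>0 < e\<close> by blast
qed

text \<open>Each level set is replaced by a set from \<open>G\<close>. The replacements may overlap,
  so the approximant is a sum of indicators and need not take the value \<open>y\<close> on
  \<open>B y\<close>.\<close>

lemma simple_function_step_approx:
  fixes s :: "'m \<Rightarrow> 'b::real_normed_vector"
  assumes "finite_measure M" and alg: "algebra (space M) G"
    and sets: "sets M = sigma_sets (space M) G"
    and s: "simple_function M s" and "0 < e"
  shows "\<exists>Y B. finite Y \<and> (\<forall>y\<in>Y. B y \<in> G) \<and>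
    (\<integral>\<^sup>+ t. ennreal (norm (s t - (\<Sum>y\<in>Y. indicator (B y) t *\<^sub>R y))) \<partial>M) \<le> ennreal e"
proof -
  interpret finite_measure M by fact
  define Y where "Y = s ` space M"
  have fin: "finite Y" using s by (auto simp: Y_def simple_function_def)
  define A where "A y = s -` {y} \<inter> space M" for y
  have A: "A y \<in> sets M" for y unfolding A_def using s by (rule simple_functionD)
  \<comment> \<open>An error of \<open>e / S\<close> in the level set of \<open>y\<close> costs
    \<open>norm y * (e / S)\<close>. Adding 1 keeps \<open>S\<close> positive if there are no
    nonzero values.\<close>
  define S where "S = (\<Sum>y\<in>Y. norm y) + 1"
  have S: "0 < S" unfolding S_def by (simp add: add_nonneg_pos sum_nonneg)
  have "\<exists>B. B \<in> G \<and> measure M (sym_diff (A y) B) < e / S" for y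
    using algebra_dense_in_sigma_sets[OF \<open>finite_measure M\<close> alg sets A] S \<open>0 < e\<close>
    by (auto simp: Bex_def)
  then obtain B where B: "\<And>y. B y \<in> G" "\<And>y. measure M (sym_diff (A y) (B y)) < e / S"
    by metis
  have Bs: "B y \<in> sets M" for y using B(1) sets by auto
  have sd: "sym_diff (A y) (B y) \<in> sets M" for y using A Bs by auto
  have pw: "norm (s t - (\<Sum>y\<in>Y. indicator (B y) t *\<^sub>R y)) \<le>
      (\<Sum>y\<in>Y. norm y * indicator (sym_diff (A y) (B y)) t)" if "t \<in> space M" for t
  proof -
    have "s t = (\<Sum>y\<in>Y. indicator (A y) t *\<^sub>R y)"
    proof -
      have "(\<Sum>y\<in>Y. indicator (A y) t *\<^sub>R y) = (\<Sum>y\<in>Y. if s t = y then y else 0)"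
        using that by (intro sum.cong) (auto simp: A_def indicator_def)
      also have "\<dots> = s t" using fin that by (simp add: Y_def)
      finally show ?thesis by simp
    qed
    then have "norm (s t - (\<Sum>y\<in>Y. indicator (B y) t *\<^sub>R y)) =
        norm (\<Sum>y\<in>Y. (indicator (A y) t - indicator (B y) t) *\<^sub>R y)"
      by (simp add: sum_subtractf algebra_simps)
    also have "\<dots> \<le> (\<Sum>y\<in>Y. norm ((indicator (A y) t - indicator (B y) t) *\<^sub>R y))"
      by (rule norm_sum)
    also have "\<dots> \<le> (\<Sum>y\<in>Y. norm y * indicator (sym_diff (A y) (B y)) t)"
      by (intro sum_mono) (auto simp: indicator_def)
    finally show ?thesis .
  qed
  have "(\<integral>\<^sup>+ t. ennreal (norm (s t - (\<Sum>y\<in>Y. indicator (B y) t *\<^sub>R y))) \<partial>M) \<le>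
     (\<integral>\<^sup>+ t. (\<Sum>y\<in>Y. ennreal (norm y) * indicator (sym_diff (A y) (B y)) t) \<partial>M)"
  proof (rule nn_integral_mono)
    fix t assume t: "t \<in> space M"
    have "ennreal (norm (s t - (\<Sum>y\<in>Y. indicator (B y) t *\<^sub>R y))) \<le>
      ennreal (\<Sum>y\<in>Y. norm y * indicator (sym_diff (A y) (B y)) t)"
      using pw[OF t] by (rule ennreal_leI)
    also have "\<dots> = (\<Sum>y\<in>Y. ennreal (norm y * indicator (sym_diff (A y) (B y)) t))"
      by (intro sum_ennreal[symmetric]) auto
    also have "\<dots> = (\<Sum>y\<in>Y. ennreal (norm y) * indicator (sym_diff (A y) (B y)) t)"
      by (intro sum.cong) (auto simp: indicator_def)
    finally show "ennreal (norm (s t - (\<Sum>y\<in>Y. indicator (B y) t *\<^sub>R y))) \<le> \<dots>" .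
  qed
  also have "\<dots> = (\<Sum>y\<in>Y. ennreal (norm y) * emeasure M (sym_diff (A y) (B y)))"
    using sd by (subst nn_integral_sum) (auto simp: nn_integral_cmult_indicator)
  also have "\<dots> = (\<Sum>y\<in>Y. ennreal (norm y * measure M (sym_diff (A y) (B y))))"
    by (simp add: emeasure_eq_measure ennreal_mult)
  also have "\<dots> = ennreal (\<Sum>y\<in>Y. norm y * measure M (sym_diff (A y) (B y)))"
    by (intro sum_ennreal) auto
  also have "\<dots> \<le> ennreal e"
  proof (rule ennreal_leI)
    have "(\<Sum>y\<in>Y. norm y * measure M (sym_diff (A y) (B y))) \<le> (\<Sum>y\<in>Y. norm y * (e / S))"
      using B(2) by (intro sum_mono mult_left_mono) (auto intro: less_imp_le)
    also have "\<dots> = (S - 1) * (e / S)" unfolding S_def by (simp only: sum_distrib_right add_diff_cancel_right')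
    also have "\<dots> \<le> S * (e / S)" using S \<open>0 < e\<close> by (intro mult_right_mono) auto
    also have "\<dots> = e" using S by simp
    finally show "(\<Sum>y\<in>Y. norm y * measure M (sym_diff (A y) (B y))) \<le> e" .
  qed
  finally show ?thesis using fin B(1) by blast
qed

text \<open>Without second countability a limit \<open>g\<close> of simple functions need not have measurable
  differences with other functions, but \<open>norm (g - s)\<close> is measurable for simple \<open>s\<close>.\<close>

lemma AE_limit_simple_functions:
  fixes f :: "'m \<Rightarrow> 'b::real_normed_vector"
  assumes s: "\<And>n. simple_function M (s n)" and lim: "AE t in M. (\<lambda>n. s n t) \<longlonglongrightarrow> f t"
  obtains g where "AE t in M. f t = g t"
    "\<And>r. simple_function M r \<Longrightarrow> (\<lambda>t. norm (g t - r t)) \<in> borel_measurable M"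
proof -
  obtain N where N: "N \<in> null_sets M" "{t\<in>space M. \<not> (\<lambda>n. s n t) \<longlonglongrightarrow> f t} \<subseteq> N"
    using lim by (auto simp: eventually_ae_filter)
  \<comment> \<open>Putting 0 on the exceptional set turns convergence almost everywhere into
    convergence everywhere on the space, once each \<open>s n\<close> is cut off in the same
    way.\<close>
  define g where "g t = (if t \<in> N then 0 else f t)" for t
  have "AE t in M. f t = g t"
    using AE_not_in[OF N(1)] by eventually_elim (simp add: g_def)
  moreover have "(\<lambda>t. norm (g t - r t)) \<in> borel_measurable M" if r: "simple_function M r" for r
  proof (rule borel_measurable_LIMSEQ_real)
    fix t assume t: "t \<in> space M"
    have "(\<lambda>n. indicator (space M - N) t *\<^sub>R s n t) \<longlonglongrightarrow> g t"
      using t N by (cases "t \<in> N") (auto simp: g_def)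
    then show "(\<lambda>n. norm (indicator (space M - N) t *\<^sub>R s n t - r t)) \<longlonglongrightarrow> norm (g t - r t)"
      by (intro tendsto_intros)
  next
    fix n
    have "simple_function M (indicator (space M - N) :: 'm \<Rightarrow> real)"
      using N by (intro simple_function_indicator) auto
    then have "simple_function M (\<lambda>t. indicator (space M - N) t *\<^sub>R s n t)"
      using s by (rule simple_function_compose2)
    then have "simple_function M (\<lambda>t. norm (indicator (space M - N) t *\<^sub>R s n t - r t))"
      using r by (rule simple_function_compose2)
    then show "(\<lambda>t. norm (indicator (space M - N) t *\<^sub>R s n t - r t)) \<in> borel_measurable M"
      by (rule borel_measurable_simple_function)
  qed
  ultimately show ?thesis by (rule that)
qed

section \<open>Bochner densities on finite measure spaces\<close>

lemma simple_bochner_integrable_finite_measure: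
  assumes "finite_measure M" "simple_function M s"
  shows "Bochner_Integration.simple_bochner_integrable M s"
  using assms by (intro simple_bochner_integrable.intros)
    (auto simp: finite_measure.emeasure_finite)

lemma simple_function_scaleR_indicator:
  assumes "A \<in> sets M" "simple_function M s"
  shows "simple_function M (\<lambda>t. indicator A t *\<^sub>R s t)"
  by (rule simple_function_compose2[OF simple_function_indicator[OF assms(1)] assms(2)])

lemma norm_simple_bochner_integral_diff_le:
  assumes "finite_measure M" and s: "simple_function M s" and r: "simple_function M r"
  shows "ennreal (norm (Bochner_Integration.simple_bochner_integral M s -
      Bochner_Integration.simple_bochner_integral M r)) \<le> (\<integral>\<^sup>+ t. ennreal (norm (s t - r t)) \<partial>M)"
proof -
  note i = simple_bochner_integrable_finite_measure[OF assms(1)]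
  have d: "simple_function M (\<lambda>t. s t - r t)" "simple_function M (\<lambda>t. norm (s t - r t))"
    using s r by (auto intro: simple_function_compose2)
  have "norm (Bochner_Integration.simple_bochner_integral M s -
      Bochner_Integration.simple_bochner_integral M r) =
      norm (Bochner_Integration.simple_bochner_integral M (\<lambda>t. s t - r t))"
    by (simp add: simple_bochner_integral_diff i s r)
  also have "ennreal \<dots> \<le>
      ennreal (Bochner_Integration.simple_bochner_integral M (\<lambda>t. norm (s t - r t)))"
    by (intro ennreal_leI simple_bochner_integral_norm_bound i d)
  also have "\<dots> = (\<integral>\<^sup>+ t. ennreal (norm (s t - r t)) \<partial>M)"
    by (intro simple_bochner_integral_eq_nn_integral i d) simp
  finally show ?thesis .
qed

text \<open>The integral over each \<open>A\<close> comes with its own approximating functions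
  \<open>q n\<close>, whereas one \<open>s\<close> is wanted for all \<open>A\<close>. It is taken
  from the integral over the whole space; the integrals of \<open>q n\<close> are compared with that
  of \<open>s\<close> over \<open>A\<close>, and then \<open>n\<close> tends to infinity.\<close>

lemma bochner_density_simple_approx:
  fixes f :: "'m \<Rightarrow> 'b::banach"
  assumes "finite_measure M"
    and f: "\<forall>A\<in>sets M. bochner_integral_of M (\<lambda>t. indicator A t *\<^sub>R f t) (\<nu> A)" and "0 < e"
  shows "\<exists>s h. simple_function M s \<and> h \<in> borel_measurable M \<and> (\<integral>\<^sup>+ t. h t \<partial>M) \<le> ennreal e \<and>
    (\<forall>A\<in>sets M. ennreal (norm (\<nu> A -
        Bochner_Integration.simple_bochner_integral M (\<lambda>t. indicator A t *\<^sub>R s t)))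
      \<le> (\<integral>\<^sup>+ t. h t * indicator A t \<partial>M))"
proof -
  have sb: "simple_function M r" if "Bochner_Integration.simple_bochner_integrable M r" for r :: "'m \<Rightarrow> 'b"
    using that by (auto elim: simple_bochner_integrable.cases)
  from f obtain s0 where s0: "\<And>n. simple_function M (s0 n)"
    "AE t in M. (\<lambda>n. s0 n t) \<longlonglongrightarrow> indicator (space M) t *\<^sub>R f t"
    "(\<lambda>n. \<integral>\<^sup>+ t. ennreal (norm (indicator (space M) t *\<^sub>R f t - s0 n t)) \<partial>M) \<longlonglongrightarrow> 0"
    unfolding bochner_integral_of_def by (meson sb sets.top)
  have "AE t in M. (\<lambda>n. s0 n t) \<longlonglongrightarrow> f t"
    using s0(2) AE_space by eventually_elim simp
  \<comment> \<open>Additivity of the integral needs measurable norms, which \<open>g\<close> has;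
    the results are carried back to \<open>f\<close> almost everywhere.\<close>
  then obtain g where g: "AE t in M. f t = g t"
    "\<And>r. simple_function M r \<Longrightarrow> (\<lambda>t. norm (g t - r t)) \<in> borel_measurable M"
    using s0(1) AE_limit_simple_functions[of M s0 f] by blast
  have "\<forall>\<^sub>F n in sequentially.
     (\<integral>\<^sup>+ t. ennreal (norm (indicator (space M) t *\<^sub>R f t - s0 n t)) \<partial>M) < ennreal e"
    using s0(3) \<open>0 < e\<close> by (intro order_tendstoD) auto
  then obtain n where n: "(\<integral>\<^sup>+ t. ennreal (norm (indicator (space M) t *\<^sub>R f t - s0 n t)) \<partial>M) < ennreal e"
    by (auto simp: eventually_sequentially)
  define s where "s = s0 n"
  define h where "h t = ennreal (norm (g t - s t))" for t
  have s: "simple_function M s" unfolding s_def by (rule s0)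
  have h: "h \<in> borel_measurable M" unfolding h_def using g(2)[OF s] by measurable
  have "(\<integral>\<^sup>+ t. h t \<partial>M) = (\<integral>\<^sup>+ t. ennreal (norm (indicator (space M) t *\<^sub>R f t - s0 n t)) \<partial>M)"
  proof (rule nn_integral_cong_AE)
    show "AE t in M. h t = ennreal (norm (indicator (space M) t *\<^sub>R f t - s0 n t))"
      using g(1) AE_space by eventually_elim (simp add: h_def s_def)
  qed
  with n have he: "(\<integral>\<^sup>+ t. h t \<partial>M) \<le> ennreal e" by simp
  moreover have "ennreal (norm (\<nu> A -
        Bochner_Integration.simple_bochner_integral M (\<lambda>t. indicator A t *\<^sub>R s t)))
      \<le> (\<integral>\<^sup>+ t. h t * indicator A t \<partial>M)" if A: "A \<in> sets M" for A
  proof -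
    let ?I = "Bochner_Integration.simple_bochner_integral M"
    from f A obtain q where q: "\<And>n. simple_function M (q n)"
      "(\<lambda>n. \<integral>\<^sup>+ t. ennreal (norm (indicator A t *\<^sub>R f t - q n t)) \<partial>M) \<longlonglongrightarrow> 0"
      "(\<lambda>n. ?I (q n)) \<longlonglongrightarrow> \<nu> A"
      unfolding bochner_integral_of_def by (meson sb)
    let ?s = "\<lambda>t. indicator A t *\<^sub>R s t"
    have s': "simple_function M ?s" using A s by (rule simple_function_scaleR_indicator)
    have ga: "(\<lambda>t. norm (indicator A t *\<^sub>R g t - r t)) \<in> borel_measurable M"
      if r: "simple_function M r" for r
    proof -
      have [measurable]: "(\<lambda>t. norm (g t - r t)) \<in> borel_measurable M"
        "(\<lambda>t. norm (r t)) \<in> borel_measurable M" "A \<in> sets M"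
        using r g(2) A by (auto intro!: borel_measurable_simple_function simple_function_compose1[OF r])
      have "(\<lambda>t. norm (indicator A t *\<^sub>R g t - r t)) =
          (\<lambda>t. if t \<in> A then norm (g t - r t) else norm (r t))"
        by (auto simp: fun_eq_iff)
      then show ?thesis by simp
    qed
    have bnd: "ennreal (norm (?I (q n) - ?I ?s)) \<le>
      (\<integral>\<^sup>+ t. ennreal (norm (indicator A t *\<^sub>R f t - q n t)) \<partial>M) + (\<integral>\<^sup>+ t. h t * indicator A t \<partial>M)" for n
    proof -
      have [measurable]: "(\<lambda>t. norm (indicator A t *\<^sub>R g t - q n t)) \<in> borel_measurable M"
        "h \<in> borel_measurable M" "A \<in> sets M" using ga q h A by auto
      have "ennreal (norm (?I (q n) - ?I ?s)) \<le> (\<integral>\<^sup>+ t. ennreal (norm (q n t - ?s t)) \<partial>M)"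
        by (rule norm_simple_bochner_integral_diff_le[OF assms(1) q(1) s'])
      also have "\<dots> \<le> (\<integral>\<^sup>+ t. ennreal (norm (indicator A t *\<^sub>R g t - q n t)) + h t * indicator A t \<partial>M)"
      proof (rule nn_integral_mono)
        fix t
        have "norm (q n t - ?s t) \<le> norm (indicator A t *\<^sub>R g t - q n t) + norm (indicator A t *\<^sub>R g t - ?s t)"
          by (metis add.commute norm_diff_triangle_ineq norm_minus_commute norm_triangle_le_diff dist_norm dist_triangle3 )
        also have "norm (indicator A t *\<^sub>R g t - ?s t) = norm (g t - s t) * indicator A t"
          by (auto simp: indicator_def)
        finally have "ennreal (norm (q n t - ?s t)) \<le>
          ennreal (norm (indicator A t *\<^sub>R g t - q n t) + norm (g t - s t) * indicator A t)"
          by (rule ennreal_leI)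
        also have "\<dots> = ennreal (norm (indicator A t *\<^sub>R g t - q n t)) + h t * indicator A t"
          by (auto simp: indicator_def h_def ennreal_plus)
        finally show "ennreal (norm (q n t - ?s t)) \<le> \<dots>" .
      qed
      also have "\<dots> = (\<integral>\<^sup>+ t. ennreal (norm (indicator A t *\<^sub>R g t - q n t)) \<partial>M)
          + (\<integral>\<^sup>+ t. h t * indicator A t \<partial>M)"
        by (rule nn_integral_add) measurable
      also have "(\<integral>\<^sup>+ t. ennreal (norm (indicator A t *\<^sub>R g t - q n t)) \<partial>M) =
          (\<integral>\<^sup>+ t. ennreal (norm (indicator A t *\<^sub>R f t - q n t)) \<partial>M)"
      proof (rule nn_integral_cong_AE)
        show "AE t in M. ennreal (norm (indicator A t *\<^sub>R g t - q n t)) =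
            ennreal (norm (indicator A t *\<^sub>R f t - q n t))"
          using g(1) by eventually_elim simp
      qed
      finally show ?thesis .
    qed
    have "(\<lambda>n. ennreal (norm (?I (q n) - ?I ?s))) \<longlonglongrightarrow> ennreal (norm (\<nu> A - ?I ?s))"
      using q(3) by (intro tendsto_intros)
    moreover have "(\<lambda>n. (\<integral>\<^sup>+ t. ennreal (norm (indicator A t *\<^sub>R f t - q n t)) \<partial>M)
        + (\<integral>\<^sup>+ t. h t * indicator A t \<partial>M)) \<longlonglongrightarrow> 0 + (\<integral>\<^sup>+ t. h t * indicator A t \<partial>M)"
      using q(2) by (intro tendsto_add tendsto_const)
    ultimately show ?thesis
      using bnd by (intro LIMSEQ_le[where X="\<lambda>n. ennreal (norm (?I (q n) - ?I ?s))"]) auto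
  qed
  ultimately show ?thesis using s h by blast
qed

text \<open>Domination turns finite into countable additivity: on the remainder of a union after
  \<open>n\<close> sets, \<open>\<nu>\<close> is bounded by \<open>K\<close> times a measure that
  tends to 0.\<close>

lemma
  fixes \<nu> :: "'m set \<Rightarrow> 'b::banach"
  assumes "finite_measure M"
    and add: "\<And>A B. A \<in> sets M \<Longrightarrow> B \<in> sets M \<Longrightarrow> A \<inter> B = {} \<Longrightarrow> \<nu> (A \<union> B) = \<nu> A + \<nu> B"
    and bound: "\<And>A. A \<in> sets M \<Longrightarrow> norm (\<nu> A) \<le> K * measure M A"
  shows vector_measure_dominated: "vector_measure M \<nu>"
    and bounded_variation_dominated: "bounded_variation M \<nu>"
    and vanishes_on_null_sets_dominated: "vanishes_on_null_sets M \<nu>"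
proof -
  interpret finite_measure M by fact
  have null: "\<nu> A = 0" if "A \<in> sets M" "measure M A = 0" for A
    using bound[OF that(1)] that by simp
  have fin: "\<nu> (\<Union>i<n. A i) = (\<Sum>i<n. \<nu> (A i))"
    if "range A \<subseteq> sets M" "disjoint_family A" for A :: "nat \<Rightarrow> 'm set" and n
  proof (induction n)
    case 0
    then show ?case using null[of "{}"] by simp
  next
    case (Suc n)
    have "\<nu> ((\<Union>i<n. A i) \<union> A n) = \<nu> (\<Union>i<n. A i) + \<nu> (A n)"
    proof (rule add)
      show "(\<Union>i<n. A i) \<in> sets M" "A n \<in> sets M" using that by auto
      have "A i \<inter> A n = {}" if "i < n" for i
        using \<open>disjoint_family A\<close> that by (simp add: disjoint_family_on_def)
      then show "(\<Union>i<n. A i) \<inter> A n = {}" by blast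
    qed
    moreover have "(\<Union>i<Suc n. A i) = (\<Union>i<n. A i) \<union> A n" by (auto simp: lessThan_Suc)
    ultimately show ?case using Suc by simp
  qed
  show "vector_measure M \<nu>"
    unfolding vector_measure_def
  proof (intro allI impI)
    fix A :: "nat \<Rightarrow> 'm set" assume A: "range A \<subseteq> sets M" "disjoint_family A"
    let ?R = "\<lambda>n. (\<Union>n. A n) - (\<Union>i<n. A i)"
    have U: "(\<Union>n. A n) \<in> sets M" "(\<Union>i<n. A i) \<in> sets M" for n using A(1) by auto
    have disj: "disjoint_family_on A {..<n}" for n
      using A(2) by (rule disjoint_family_on_mono[rotated]) simp
    have "(\<lambda>n. \<Sum>i<n. measure M (A i)) \<longlonglongrightarrow> measure M (\<Union>n. A n)"
      using finite_measure_UNION[OF A] by (simp add: sums_def)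
    moreover have "(\<Sum>i<n. measure M (A i)) = measure M (\<Union>i<n. A i)" for n
      using A(1) disj by (intro finite_measure_finite_Union[symmetric]) auto
    ultimately have "(\<lambda>n. measure M (\<Union>n. A n) - measure M (\<Union>i<n. A i)) \<longlonglongrightarrow>
        measure M (\<Union>n. A n) - measure M (\<Union>n. A n)"
      by (intro tendsto_diff tendsto_const) simp
    then have lim: "(\<lambda>n. K * measure M (?R n)) \<longlonglongrightarrow> K * 0"
      using U by (intro tendsto_mult tendsto_const) (simp add: finite_measure_Diff UN_subset_iff UN_upper)
    have split: "\<nu> (\<Union>n. A n) = (\<Sum>i<n. \<nu> (A i)) + \<nu> (?R n)" for n
    proof -
      have "\<nu> ((\<Union>i<n. A i) \<union> ?R n) = \<nu> (\<Union>i<n. A i) + \<nu> (?R n)"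
        using U by (intro add) auto
      moreover have "(\<Union>i<n. A i) \<union> ?R n = (\<Union>n. A n)" by auto
      ultimately show ?thesis using fin[OF A] by simp
    qed
    have rest: "norm ((\<Sum>i<n. \<nu> (A i)) - \<nu> (\<Union>n. A n)) \<le> K * measure M (?R n)" for n
      using bound[OF sets.Diff[OF U(1) U(2)[of n]]] unfolding split[of n] by simp
    have "(\<lambda>n. (\<Sum>i<n. \<nu> (A i)) - \<nu> (\<Union>n. A n)) \<longlonglongrightarrow> 0"
      using lim unfolding mult_zero_right
      by (rule Lim_null_comparison[rotated]) (intro always_eventually allI rest)
    then show "(\<lambda>n. \<nu> (A n)) sums \<nu> (\<Union>n. A n)"
      unfolding sums_def by (rule LIM_zero_cancel)
  qed
  show "bounded_variation M \<nu>"
    unfolding bounded_variation_def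
  proof (intro exI allI impI)
    fix P assume P: "finite P" "P \<subseteq> sets M" "disjoint P"
    \<comment> \<open>No sign is assumed for \<open>K\<close>; its absolute value makes the bound
      monotone in the measure.\<close>
    have "(\<Sum>A\<in>P. norm (\<nu> A)) \<le> (\<Sum>A\<in>P. \<bar>K\<bar> * measure M A)"
    proof (rule sum_mono)
      fix A assume "A \<in> P"
      then have "norm (\<nu> A) \<le> K * measure M A" using P bound by auto
      also have "\<dots> \<le> \<bar>K\<bar> * measure M A" by (intro mult_right_mono) auto
      finally show "norm (\<nu> A) \<le> \<bar>K\<bar> * measure M A" .
    qed
    also have "\<dots> = \<bar>K\<bar> * measure M (\<Union>A\<in>P. A)"
      using P by (subst finite_measure_finite_Union)
        (auto simp: sum_distrib_left disjoint_family_on_def disjoint_def)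
    also have "\<dots> \<le> \<bar>K\<bar> * measure M (space M)"
      by (intro mult_left_mono bounded_measure) auto
    finally show "(\<Sum>A\<in>P. norm (\<nu> A)) \<le> \<bar>K\<bar> * measure M (space M)" .
  qed
  show "vanishes_on_null_sets M \<nu>"
    unfolding vanishes_on_null_sets_def using null by (auto simp: null_sets_def measure_def)
qed

lemma simple_bochner_integral_indicator_scaleR:
  assumes "finite_measure M" "A \<in> sets M"
  shows "Bochner_Integration.simple_bochner_integral M (\<lambda>t. indicator A t *\<^sub>R r) = measure M A *\<^sub>R r"
proof -
  have "linear (\<lambda>a::real. a *\<^sub>R r)" by (simp add: linear_scale_left linear_iff scaleR_add_left)
  moreover have i: "Bochner_Integration.simple_bochner_integrable M (indicator A :: _ \<Rightarrow> real)"
    using assms by (intro simple_bochner_integrable_finite_measure simple_function_indicator)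
  ultimately have "Bochner_Integration.simple_bochner_integral M (\<lambda>t. indicator A t *\<^sub>R r) =
     Bochner_Integration.simple_bochner_integral M (indicator A) *\<^sub>R r"
    by (rule simple_bochner_integral_linear)
  moreover have "ennreal (Bochner_Integration.simple_bochner_integral M (indicator A)) =
      ennreal (measure M A)"
    using assms by (subst simple_bochner_integral_eq_nn_integral[OF i])
      (auto simp: finite_measure.emeasure_eq_measure ennreal_indicator)
  then have "Bochner_Integration.simple_bochner_integral M (indicator A) = measure M A"
    by (subst (asm) ennreal_inj) (auto intro: simple_bochner_integral_nonneg)
  ultimately show ?thesis by simp
qed

section \<open>The measure of a nested sequence of divisions\<close>

text \<open>The number \<open>x n i\<close> is the \<open>i\<close>-th division point of level \<open>n\<close>, and \<open>v n i\<close> is the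
  image of the point of the \<open>n\<close>-th geodesic associated with it.\<close>

locale divisions =
  fixes N :: "nat \<Rightarrow> nat" and x :: "nat \<Rightarrow> nat \<Rightarrow> real" and v :: "nat \<Rightarrow> nat \<Rightarrow> 'b::banach" and K :: real
  assumes step: "i < N n \<Longrightarrow> x n i < x n (Suc i)"
    and first: "x n 0 = 0" and last: "x n (N n) = 1"
    and refine: "i \<le> N n \<Longrightarrow> \<exists>j\<le>N (Suc n). x (Suc n) j = x n i \<and> v (Suc n) j = v n i"
    and lipschitz: "i < N n \<Longrightarrow> norm (v n (Suc i) - v n i) \<le> K * (x n (Suc i) - x n i)"
begin

text \<open>Half-open, so that the cells of one level cover \<open>{0..<1}\<close> without
  overlaps.\<close>

definition cell :: "nat \<Rightarrow> nat \<Rightarrow> real set" where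
  "cell n i = {x n i..<x n (Suc i)}"

definition slope :: "nat \<Rightarrow> nat \<Rightarrow> 'b" where
  "slope n i = (v n (Suc i) - v n i) /\<^sub>R (x n (Suc i) - x n i)"

text \<open>The meshes of the divisions need not tend to 0.  The sigma-algebra generated by the cells,
  unlike the Borel one, is still approximated in measure by finite unions of cells.\<close>

definition alg :: "nat \<Rightarrow> real set set" where
  "alg n = {A. A \<subseteq> {0..<1} \<and> (\<forall>i<N n. cell n i \<subseteq> A \<or> cell n i \<inter> A = {})}"

text \<open>Taking the image under the identity is the way to pass to a smaller sigma-algebra: this
  is Lebesgue measure on \<open>{0..<1}\<close>, restricted to the sets generated by all
  cells.\<close>

definition M :: "real measure" where
  "M = distr (restrict_space lborel {0..<1}) (sigma {0..<1} (\<Union>n. alg n)) (\<lambda>t. t)"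

text \<open>\<open>T n A\<close> is the integral over \<open>A\<close> of the \<open>n\<close>-th term of the martingale formed by the
  slopes.\<close>

definition T :: "nat \<Rightarrow> real set \<Rightarrow> 'b" where
  "T n A = (\<Sum>i<N n. measure M (A \<inter> cell n i) *\<^sub>R slope n i)"

text \<open>On a union of cells the sequence is eventually constant; on the other sets of
  \<open>M\<close> the limit exists by approximation.\<close>

definition \<nu> :: "real set \<Rightarrow> 'b" where
  "\<nu> A = lim (\<lambda>n. T n A)"

section \<open>Order of the division points and cells\<close>

lemma x_less: "i < j \<Longrightarrow> j \<le> N n \<Longrightarrow> x n i < x n j"
proof (induction j)
  case (Suc j)
  then show ?case using step[of j n] by (cases "i = j") (auto simp: less_Suc_eq)
qed simp

lemma x_le: "i \<le> j \<Longrightarrow> j \<le> N n \<Longrightarrow> x n i \<le> x n j"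
  using x_less[of i j n] by (cases "i = j") auto

lemma x_less_iff: "i \<le> N n \<Longrightarrow> j \<le> N n \<Longrightarrow> x n i < x n j \<longleftrightarrow> i < j"
  using x_less[of i j n] x_le[of j i n] by (meson leD not_less)

lemma x_le_iff: "i \<le> N n \<Longrightarrow> j \<le> N n \<Longrightarrow> x n i \<le> x n j \<longleftrightarrow> i \<le> j"
  using x_less_iff[of j n i] by (auto simp: not_less[symmetric])

lemma x_nonneg: "i \<le> N n \<Longrightarrow> 0 \<le> x n i"
  using x_le[of 0 i n] first by simp

lemma x_le_1: "i \<le> N n \<Longrightarrow> x n i \<le> 1"
  using x_le[of i "N n" n] last by simp

lemma cell_disjoint: "i < N n \<Longrightarrow> j < N n \<Longrightarrow> i \<noteq> j \<Longrightarrow> cell n i \<inter> cell n j = {}"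
  using x_le[of "Suc i" j n] x_le[of "Suc j" i n]
  by (cases "i < j") (auto simp: cell_def)

lemma cell_subset: "i < N n \<Longrightarrow> cell n i \<subseteq> {0..<1}"
  using x_nonneg[of i n] x_le_1[of "Suc i" n] by (auto simp: cell_def)

lemma cell_cover: "t \<in> {0..<1} \<Longrightarrow> \<exists>i<N n. t \<in> cell n i"
proof -
  assume t: "t \<in> {0..<1}"
  have "\<exists>i<m. t \<in> cell n i" if "t < x n m" "m \<le> N n" for m
    using that
  proof (induction m)
    case 0
    then show ?case using t first by auto
  next
    case (Suc m)
    then show ?case by (cases "t < x n m") (auto simp: cell_def less_Suc_eq)
  qed
  then show ?thesis using t last by auto
qed

lemma refine_later:
  assumes "n \<le> m" "i \<le> N n"
  shows "\<exists>j\<le>N m. x m j = x n i \<and> v m j = v n i"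
  using assms(1)
proof (induction rule: dec_induct)
  case base
  then show ?case using assms(2) by auto
next
  case (step m)
  then show ?case using refine by metis
qed

section \<open>Algebras of unions of cells\<close>

lemma interval_alg:
  assumes "n \<le> m" "i \<le> N n" "j \<le> N n"
  shows "{x n i..<x n j} \<in> alg m"
proof -
  obtain a where a: "a \<le> N m" "x m a = x n i" using refine_later assms by blast
  obtain b where b: "b \<le> N m" "x m b = x n j" using refine_later assms by blast
  have "cell m k \<subseteq> {x m a..<x m b} \<or> cell m k \<inter> {x m a..<x m b} = {}" if "k < N m" for k
  proof (cases "a \<le> k \<and> k < b")
    case True
    then show ?thesis using x_le[of a k m] x_le[of "Suc k" b m] that b by (auto simp: cell_def)
  next
    case False
    then show ?thesis using x_le[of "Suc k" a m] x_le[of b k m] that a by (auto simp: cell_def)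
  qed
  moreover have "{x m a..<x m b} \<subseteq> {0..<1}" using x_nonneg[OF a(1)] x_le_1[OF b(1)] by auto
  ultimately show ?thesis using a b by (auto simp: alg_def)
qed

lemma cell_alg: "n \<le> m \<Longrightarrow> i < N n \<Longrightarrow> cell n i \<in> alg m"
  unfolding cell_def by (rule interval_alg) auto

lemma alg_eq_UN: "A \<in> alg n \<Longrightarrow> A = (\<Union>i\<in>{i. i < N n \<and> cell n i \<subseteq> A}. cell n i)"
proof -
  assume A: "A \<in> alg n"
  have "\<exists>i. i < N n \<and> cell n i \<subseteq> A \<and> t \<in> cell n i" if "t \<in> A" for t
  proof -
    have "t \<in> {0..<1}" using A that by (auto simp: alg_def)
    then obtain i where "i < N n" "t \<in> cell n i" using cell_cover by blast
    then show ?thesis using A that unfolding alg_def by blast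
  qed
  then show ?thesis by blast
qed

text \<open>The coarser cells belong to the finer algebra, so a finer cell is contained in each of
  them or disjoint from it.\<close>

lemma alg_mono: "n \<le> m \<Longrightarrow> alg n \<subseteq> alg m"
proof
  fix A assume nm: "n \<le> m" and A: "A \<in> alg n"
  have c: "cell n i \<in> alg m" if "i < N n" for i using nm that by (rule cell_alg)
  show "A \<in> alg m"
    unfolding alg_def
  proof (intro CollectI conjI allI impI)
    show "A \<subseteq> {0..<1}" using A by (auto simp: alg_def)
    fix k assume k: "k < N m"
    show "cell m k \<subseteq> A \<or> cell m k \<inter> A = {}"
    proof (cases "\<exists>i<N n. cell n i \<subseteq> A \<and> cell m k \<subseteq> cell n i")
      case False
      then have "cell m k \<inter> cell n i = {}" if "i < N n" "cell n i \<subseteq> A" for i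
        using c[OF that(1)] k that by (auto simp: alg_def)
      then show ?thesis using alg_eq_UN[OF A] by blast
    qed blast
  qed
qed

lemma alg_subset_Pow: "(\<Union>n. alg n) \<subseteq> Pow {0..<1}"
  by (auto simp: alg_def)

lemma algebra_alg: "algebra {0..<1} (\<Union>n. alg n)"
  unfolding algebra_iff_Un
proof (intro conjI ballI)
  show "(\<Union>n. alg n) \<subseteq> Pow {0..<1}" "{} \<in> (\<Union>n. alg n)" by (auto simp: alg_def)
  fix A assume "A \<in> (\<Union>n. alg n)"
  then obtain n where A: "A \<in> alg n" by auto
  then have "{0..<1} - A \<in> alg n" using cell_subset[of _ n] unfolding alg_def by blast
  then show "{0..<1} - A \<in> (\<Union>n. alg n)" by auto
  fix B assume "B \<in> (\<Union>n. alg n)"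
  then obtain m where B: "B \<in> alg m" by auto
  have "A \<in> alg (max n m)" "B \<in> alg (max n m)" using A B alg_mono[of n "max n m"] alg_mono[of m "max n m"] by auto
  then have "A \<union> B \<in> alg (max n m)" unfolding alg_def by blast
  then show "A \<union> B \<in> (\<Union>n. alg n)" by auto
qed

section \<open>Lebesgue measure on the generated sigma-algebra\<close>

lemma space_M: "space M = {0..<1}"
  by (simp add: M_def space_measure_of_conv)

lemma sets_M: "sets M = sigma_sets (space M) (\<Union>n. alg n)"
  using alg_subset_Pow by (simp add: M_def space_measure_of_conv sets_measure_of)

lemma alg_sets: "A \<in> alg n \<Longrightarrow> A \<in> sets M"
  by (auto simp: sets_M)

lemma cell_sets: "i < N n \<Longrightarrow> cell n i \<in> sets M"
  using cell_alg alg_sets by blast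

lemma alg_borel: "A \<in> alg n \<Longrightarrow> A \<in> sets borel"
proof -
  assume A: "A \<in> alg n"
  have "(\<Union>i\<in>{i. i < N n \<and> cell n i \<subseteq> A}. cell n i) \<in> sets borel"
    by (intro sets.finite_UN) (auto simp: cell_def)
  then show ?thesis using alg_eq_UN[OF A] by simp
qed

lemma measurable_M: "(\<lambda>t. t) \<in> restrict_space lborel {0..<1} \<rightarrow>\<^sub>M sigma {0..<1} (\<Union>n. alg n)"
proof (rule measurable_sigma_sets)
  show "sets (sigma {0..<1} (\<Union>n. alg n)) = sigma_sets {0..<1} (\<Union>n. alg n)"
    using alg_subset_Pow by (rule sets_measure_of)
  show "(\<Union>n. alg n) \<subseteq> Pow {0..<1}" by (rule alg_subset_Pow)
  show "(\<lambda>t. t) \<in> space (restrict_space lborel {0..<1}) \<rightarrow> {0..<1}" by (auto simp: space_restrict_space)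
  fix A assume "A \<in> (\<Union>n. alg n)"
  then show "(\<lambda>t. t) -` A \<inter> space (restrict_space lborel {0..<1}) \<in> sets (restrict_space lborel {0..<1})"
    using alg_borel by (auto simp: space_restrict_space sets_restrict_space_iff)
qed

lemma emeasure_M: "A \<in> alg n \<Longrightarrow> emeasure M A = emeasure lborel A"
proof -
  assume A: "A \<in> alg n"
  then have sub: "A \<subseteq> {0..<1}" by (simp add: alg_def)
  have "emeasure M A = emeasure (restrict_space lborel {0..<1}) ((\<lambda>t. t) -` A \<inter> space (restrict_space lborel {0..<1}))"
    unfolding M_def using alg_sets[OF A] by (intro emeasure_distr[OF measurable_M]) (simp add: M_def)
  also have "(\<lambda>t. t) -` A \<inter> space (restrict_space lborel {0..<1}) = A"
    using sub by (auto simp: space_restrict_space)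
  also have "emeasure (restrict_space lborel {0..<1}) A = emeasure lborel A"
    using sub by (intro emeasure_restrict_space) auto
  finally show ?thesis .
qed

lemma finite_measure_M: "finite_measure M"
proof
  have "{0..<1} \<in> alg 0" using cell_subset[of _ 0] by (auto simp: alg_def)
  then show "emeasure M (space M) \<noteq> \<infinity>" by (simp add: emeasure_M space_M)
qed

sublocale M: finite_measure M
  by (rule finite_measure_M)

lemma measure_interval: "i \<le> j \<Longrightarrow> j \<le> N n \<Longrightarrow> measure M {x n i..<x n j} = x n j - x n i"
  using emeasure_M[OF interval_alg[of n n i j]] x_le[of i j n] by (simp add: measure_def)

section \<open>The martingale of slopes and its limit\<close>

lemma T_interval:
  assumes "i \<le> j" "j \<le> N n"
  shows "T n {x n i..<x n j} = v n j - v n i"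
proof -
  have "measure M ({x n i..<x n j} \<inter> cell n k) *\<^sub>R slope n k =
      (if k \<in> {i..<j} then v n (Suc k) - v n k else 0)" if "k < N n" for k
  proof (cases "k \<in> {i..<j}")
    case True
    then have "{x n i..<x n j} \<inter> cell n k = {x n k..<x n (Suc k)}"
      using x_le[of i k n] x_le[of "Suc k" j n] that assms by (auto simp: cell_def)
    then show ?thesis using True that step[OF that] by (simp add: measure_interval slope_def)
  next
    case False
    then have "{x n i..<x n j} \<inter> cell n k = {}"
      using x_le[of "Suc k" i n] x_le[of j k n] that assms by (auto simp: cell_def)
    then show ?thesis unfolding if_not_P[OF False] by simp
  qed
  then have "T n {x n i..<x n j} = (\<Sum>k<N n. if k \<in> {i..<j} then v n (Suc k) - v n k else 0)"
    unfolding T_def by (intro sum.cong) auto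
  also have "\<dots> = (\<Sum>k=i..<j. v n (Suc k) - v n k)"
    using assms by (intro sum.mono_neutral_cong_right) auto
  also have "\<dots> = v n j - v n i" using assms by (intro sum_Suc_diff')
  finally show ?thesis .
qed

lemma T_Un:
  assumes "A \<in> sets M" "B \<in> sets M" "A \<inter> B = {}"
  shows "T n (A \<union> B) = T n A + T n B"
proof -
  have "measure M ((A \<union> B) \<inter> cell n i) = measure M (A \<inter> cell n i) + measure M (B \<inter> cell n i)"
    if "i < N n" for i
    using assms cell_sets[OF that] by (subst M.finite_measure_Union[symmetric]) (auto simp: Int_Un_distrib2)
  then show ?thesis
    by (simp add: T_def scaleR_add_left sum.distrib)
qed

lemma norm_slope_le: "i < N n \<Longrightarrow> norm (slope n i) \<le> K"
  using lipschitz[of i n] step[of i n] by (simp add: slope_def pos_divide_le_eq divide_inverse[symmetric] mult.commute[of "inverse _"])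

lemma sum_measure_cell:
  assumes "A \<in> sets M"
  shows "(\<Sum>i<N n. measure M (A \<inter> cell n i)) = measure M A"
proof -
  have "(\<Sum>i<N n. measure M (A \<inter> cell n i)) = measure M (\<Union>i<N n. A \<inter> cell n i)"
    using assms cell_sets cell_disjoint[of _ n]
    by (intro M.finite_measure_finite_Union[symmetric]) (auto simp: disjoint_family_on_def, blast)
  also have "(\<Union>i<N n. A \<inter> cell n i) = A"
    using sets.sets_into_space[OF assms] cell_cover[of _ n] by (fastforce simp: space_M)
  finally show ?thesis .
qed

lemma norm_T_le:
  assumes "A \<in> sets M"
  shows "norm (T n A) \<le> K * measure M A"
proof -
  have "norm (T n A) \<le> (\<Sum>i<N n. K * measure M (A \<inter> cell n i))"
    unfolding T_def using norm_slope_le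
    by (intro sum_norm_le) (simp add: mult.commute[of "norm _"] mult.commute[of K] mult_left_mono)
  then show ?thesis by (simp add: sum_distrib_left[symmetric] sum_measure_cell[OF assms])
qed

text \<open>This is the martingale property. Level \<open>m\<close> keeps the division points of
  level \<open>n\<close> together with their values, so over a cell of level \<open>n\<close> both
  sums telescope to the same increment of \<open>v\<close>.\<close>

lemma T_cong_alg:
  assumes "A \<in> alg n" "n \<le> m"
  shows "T m A = T n A"
proof -
  let ?S = "{i. i < N n \<and> cell n i \<subseteq> A}"
  have cells: "T m (cell n i) = T n (cell n i)" if i: "i < N n" for i
  proof -
    obtain a where a: "a \<le> N m" "x m a = x n i" "v m a = v n i"
      using refine_later[OF assms(2), of i] i by auto
    obtain b where b: "b \<le> N m" "x m b = x n (Suc i)" "v m b = v n (Suc i)"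
      using refine_later[OF assms(2), of "Suc i"] i by auto
    have "a \<le> b" using step[OF that] a b x_le_iff[of a m b] by simp
    then have "T m (cell n i) = v n (Suc i) - v n i"
      using T_interval[of a b m] a b by (simp add: cell_def)
    moreover have "T n (cell n i) = v n (Suc i) - v n i"
      using T_interval[of i "Suc i" n] that by (simp add: cell_def)
    ultimately show ?thesis by simp
  qed
  have UN: "T k (\<Union>i\<in>S. cell n i) = (\<Sum>i\<in>S. T k (cell n i))" if "S \<subseteq> {..<N n}" for k S
    using finite_subset[OF that finite_lessThan] that
  proof (induction S)
    case empty
    then show ?case by (simp add: T_def)
  next
    case (insert i S)
    have "T k (cell n i \<union> (\<Union>i\<in>S. cell n i)) = T k (cell n i) + T k (\<Union>i\<in>S. cell n i)"
    proof (rule T_Un)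
      show "cell n i \<in> sets M" using insert cell_sets by auto
      show "(\<Union>i\<in>S. cell n i) \<in> sets M" using insert cell_sets by (intro sets.finite_UN) auto
      have "cell n i \<inter> cell n j = {}" if "j \<in> S" for j
        using insert that by (intro cell_disjoint) auto
      then show "cell n i \<inter> (\<Union>i\<in>S. cell n i) = {}" by blast
    qed
    then show ?case using insert by simp
  qed
  have "T k A = (\<Sum>i\<in>?S. T k (cell n i))" for k
    by (subst alg_eq_UN[OF assms(1)], subst UN) auto
  then show ?thesis using cells by simp
qed

text \<open>The Lipschitz constant for the distance \<open>measure M (sym_diff A B)\<close> is the
  same for all \<open>n\<close>. Hence convergence passes from the algebra of unions of cells to its
  closure under this distance, which is all of \<open>sets M\<close>.\<close>

lemma T_diff_le:
  assumes "A \<in> sets M" "B \<in> sets M"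
  shows "norm (T n A - T n B) \<le> K * measure M (sym_diff A B)"
proof -
  have split: "T n A' = T n (A' - B') + T n (A' \<inter> B')" if "A' \<in> sets M" "B' \<in> sets M" for A' B'
    using T_Un[of "A' - B'" "A' \<inter> B'" n] that by (simp add: Un_Diff_Int Diff_Int_distrib) blast
  have "T n A = T n (A - B) + T n (A \<inter> B)" "T n B = T n (B - A) + T n (A \<inter> B)"
    using split[of A B] split[of B A] assms by (simp_all add: Int_commute)
  then have "norm (T n A - T n B) = norm (T n (A - B) - T n (B - A))" by simp
  also have "\<dots> \<le> norm (T n (A - B)) + norm (T n (B - A))" by (rule norm_triangle_ineq4)
  also have "\<dots> \<le> K * measure M (A - B) + K * measure M (B - A)"
    using assms by (intro add_mono norm_T_le) auto
  also have "\<dots> = K * measure M (sym_diff A B)"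
    using assms by (subst M.finite_measure_Union) (auto simp: distrib_left)
  finally show ?thesis .
qed

lemma N_pos: "0 < N n"
  using first[of n] last[of n] by (cases "N n") auto

lemma K_nonneg: "0 \<le> K"
  using norm_slope_le[OF N_pos[of 0]] norm_ge_zero order_trans by blast

lemma convergent_T:
  assumes A: "A \<in> sets M"
  shows "convergent (\<lambda>n. T n A)"
proof (rule Cauchy_convergent, rule CauchyI)
  fix e :: real assume e: "0 < e"
  \<comment> \<open>Using \<open>K + 1\<close> instead of \<open>K\<close> avoids a division by
    0.\<close>
  define d where "d = e / (2 * (K + 1))"
  have d: "0 < d" using e K_nonneg by (simp add: d_def)
  obtain B n where B: "B \<in> alg n" "measure M (sym_diff A B) < d"
    using algebra_dense_in_sigma_sets[OF finite_measure_M _ sets_M A d] algebra_alg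
    by (auto simp: space_M)
  \<comment> \<open>From level \<open>n\<close> on the value at \<open>B\<close> is frozen, so
    staying close to it bounds the oscillation of the values at \<open>A\<close>.\<close>
  have close: "norm (T m A - T n B) < e / 2" if "n \<le> m" for m
  proof -
    have "norm (T m A - T m B) \<le> K * measure M (sym_diff A B)"
      using A B alg_sets by (intro T_diff_le) auto
    also have "\<dots> \<le> K * d" using B K_nonneg by (intro mult_left_mono) auto
    also have "\<dots> < (K + 1) * d" using d by simp
    also have "\<dots> = e / 2" using K_nonneg by (simp add: d_def field_simps add_nonneg_eq_0_iff)
    finally show ?thesis using T_cong_alg[OF B(1) that] by simp
  qed
  show "\<exists>n0. \<forall>m\<ge>n0. \<forall>k\<ge>n0. norm (T m A - T k A) < e"
  proof (intro exI[of _ n] allI impI)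
    fix m k assume "n \<le> m" "n \<le> k"
    then show "norm (T m A - T k A) < e"
      using norm_triangle_ineq4[of "T m A - T n B" "T k A - T n B"] close[of m] close[of k] by simp
  qed
qed

lemma T_tendsto: "A \<in> sets M \<Longrightarrow> (\<lambda>n. T n A) \<longlonglongrightarrow> \<nu> A"
  unfolding \<nu>_def using convergent_T convergent_LIMSEQ_iff by blast

lemma \<nu>_Un:
  assumes "A \<in> sets M" "B \<in> sets M" "A \<inter> B = {}"
  shows "\<nu> (A \<union> B) = \<nu> A + \<nu> B"
proof (rule LIMSEQ_unique)
  show "(\<lambda>n. T n (A \<union> B)) \<longlonglongrightarrow> \<nu> (A \<union> B)" using assms by (intro T_tendsto) auto
  show "(\<lambda>n. T n (A \<union> B)) \<longlonglongrightarrow> \<nu> A + \<nu> B"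
    using assms by (simp add: T_Un) (intro tendsto_add T_tendsto)
qed

lemma norm_\<nu>_le: "A \<in> sets M \<Longrightarrow> norm (\<nu> A) \<le> K * measure M A"
  using norm_T_le by (intro LIMSEQ_le_const2[OF tendsto_norm[OF T_tendsto]]) auto

lemma \<nu>_interval:
  assumes "i \<le> j" "j \<le> N n"
  shows "\<nu> {x n i..<x n j} = v n j - v n i"
proof (rule LIMSEQ_unique)
  have A: "{x n i..<x n j} \<in> alg n" using assms by (intro interval_alg) auto
  show "(\<lambda>m. T m {x n i..<x n j}) \<longlonglongrightarrow> \<nu> {x n i..<x n j}"
    using alg_sets[OF A] by (rule T_tendsto)
  have "eventually (\<lambda>m. T m {x n i..<x n j} = v n j - v n i) sequentially"
    using T_cong_alg[OF A] T_interval[OF assms] by (auto simp: eventually_sequentially)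
  then show "(\<lambda>m. T m {x n i..<x n j}) \<longlonglongrightarrow> v n j - v n i"
    by (rule tendsto_eventually)
qed

section \<open>Localization of a density to the cells\<close>

lemma sum_nn_integral_cell_le:
  assumes [measurable]: "h \<in> borel_measurable M"
  shows "(\<Sum>i<N n. \<integral>\<^sup>+ t. h t * indicator (cell n i) t \<partial>M) \<le> (\<integral>\<^sup>+ t. h t \<partial>M)"
proof -
  have [measurable]: "cell n i \<in> sets M" if "i < N n" for i using that by (rule cell_sets)
  have "(\<Sum>i<N n. \<integral>\<^sup>+ t. h t * indicator (cell n i) t \<partial>M) =
      (\<integral>\<^sup>+ t. (\<Sum>i<N n. h t * indicator (cell n i) t) \<partial>M)"
    by (intro nn_integral_sum[symmetric]) auto
  also have "\<dots> \<le> (\<integral>\<^sup>+ t. h t \<partial>M)"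
  proof (rule nn_integral_mono)
    fix t assume "t \<in> space M"
    then obtain j where j: "j < N n" "t \<in> cell n j" using cell_cover by (auto simp: space_M)
    have "(\<Sum>i<N n. h t * indicator (cell n i) t) = (\<Sum>i<N n. if i = j then h t else 0)"
      using j cell_disjoint[of _ n j] by (intro sum.cong) (auto simp: indicator_def)
    also have "\<dots> = h t" using j by simp
    finally show "(\<Sum>i<N n. h t * indicator (cell n i) t) \<le> h t" by simp
  qed
  finally show ?thesis .
qed

text \<open>Two approximations are combined, each with half of \<open>e\<close>: the density by a
  simple function \<open>s\<close>, and \<open>s\<close> by a function \<open>s'\<close> built from
  finitely many unions of cells. From some level on \<open>s'\<close> is constant on each cell, and
  \<open>r\<close> is its value there; both errors are collected in one scalar function.\<close>

lemma cellwise_density: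
  assumes rnp: "radon_nikodym_property TYPE('b)" and "0 < e"
  shows "\<exists>h n0. h \<in> borel_measurable M \<and> (\<integral>\<^sup>+ t. h t \<partial>M) \<le> ennreal e \<and>
    (\<forall>n\<ge>n0. \<forall>i<N n. \<exists>r. \<forall>A\<in>sets M. A \<subseteq> cell n i \<longrightarrow>
       ennreal (norm (\<nu> A - measure M A *\<^sub>R r)) \<le> (\<integral>\<^sup>+ t. h t * indicator A t \<partial>M))"
proof -
  let ?I = "Bochner_Integration.simple_bochner_integral M"
  obtain f where f: "\<forall>A\<in>sets M. bochner_integral_of M (\<lambda>t. indicator A t *\<^sub>R f t) (\<nu> A)"
    using rnp finite_measure_M vector_measure_dominated[of M \<nu> K] bounded_variation_dominated[of M \<nu> K]
      vanishes_on_null_sets_dominated[of M \<nu> K] \<nu>_Un norm_\<nu>_le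
    unfolding radon_nikodym_property_def by blast
  obtain s h where s: "simple_function M s" and h[measurable]: "h \<in> borel_measurable M"
    and he: "(\<integral>\<^sup>+ t. h t \<partial>M) \<le> ennreal (e / 2)"
    and hs: "\<And>A. A \<in> sets M \<Longrightarrow> ennreal (norm (\<nu> A - ?I (\<lambda>t. indicator A t *\<^sub>R s t)))
      \<le> (\<integral>\<^sup>+ t. h t * indicator A t \<partial>M)"
    using bochner_density_simple_approx[OF finite_measure_M f, of "e / 2"] \<open>0 < e\<close> by auto
  obtain Y B where Y: "finite Y" and B: "\<And>y. y \<in> Y \<Longrightarrow> B y \<in> (\<Union>n. alg n)"
    and sB: "(\<integral>\<^sup>+ t. ennreal (norm (s t - (\<Sum>y\<in>Y. indicator (B y) t *\<^sub>R y))) \<partial>M) \<le> ennreal (e / 2)"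
    using simple_function_step_approx[OF finite_measure_M _ sets_M s half_gt_zero[OF \<open>0 < e\<close>]] algebra_alg
    unfolding space_M by blast
  define s' where "s' t = (\<Sum>y\<in>Y. indicator (B y) t *\<^sub>R y)" for t
  have "simple_function M (\<lambda>t. indicator (B y) t *\<^sub>R y)" if "y \<in> Y" for y
    using B[OF that] alg_sets by (intro simple_function_scaleR_indicator) auto
  then have s': "simple_function M s'"
    unfolding s'_def by (intro simple_function_sum)
  have "\<forall>y\<in>Y. \<exists>n. B y \<in> alg n" using B by auto
  then obtain k where k: "\<And>y. y \<in> Y \<Longrightarrow> B y \<in> alg (k y)" by metis
  \<comment> \<open>Finitely many sets \<open>B y\<close> have a common level; the inserted 0 covers
    an empty \<open>Y\<close>.\<close>
  define n0 where "n0 = Max (insert 0 (k ` Y))"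
  have n0: "B y \<in> alg n" if "y \<in> Y" "n0 \<le> n" for y n
  proof -
    have "k y \<le> n0" unfolding n0_def using Y that by auto
    then show ?thesis using k[OF that(1)] alg_mono[of "k y" n] that by auto
  qed
  define h' where "h' t = h t + ennreal (norm (s t - s' t))" for t
  have [measurable]: "(\<lambda>t. norm (s t - s' t)) \<in> borel_measurable M"
    using simple_function_compose2[OF s s'] by (rule borel_measurable_simple_function)
  have h'[measurable]: "h' \<in> borel_measurable M" unfolding h'_def by measurable
  have "(\<integral>\<^sup>+ t. h' t \<partial>M) = (\<integral>\<^sup>+ t. h t \<partial>M) + (\<integral>\<^sup>+ t. ennreal (norm (s t - s' t)) \<partial>M)"
    unfolding h'_def by (rule nn_integral_add) measurable
  also have "\<dots> \<le> ennreal (e / 2) + ennreal (e / 2)"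
    using he sB by (intro add_mono) (auto simp: s'_def)
  also have "\<dots> = ennreal e" using \<open>0 < e\<close> by (simp flip: ennreal_plus)
  finally have h'e: "(\<integral>\<^sup>+ t. h' t \<partial>M) \<le> ennreal e" .
  have main: "ennreal (norm (\<nu> A - measure M A *\<^sub>R s' (x n i))) \<le> (\<integral>\<^sup>+ t. h' t * indicator A t \<partial>M)"
    if n: "n0 \<le> n" and i: "i < N n" and A[measurable]: "A \<in> sets M" and sub: "A \<subseteq> cell n i" for n i A
  proof -
    \<comment> \<open>The left end point belongs to its cell and serves as the sample point for the
      constant value of \<open>s'\<close>.\<close>
    have xc: "x n i \<in> cell n i" using step[OF i] by (simp add: cell_def)
    have "s' t = s' (x n i)" if "t \<in> A" for t
      unfolding s'_def
    proof (rule sum.cong[OF refl])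
      fix y assume "y \<in> Y"
      then have "cell n i \<subseteq> B y \<or> cell n i \<inter> B y = {}" using n0 n i by (auto simp: alg_def)
      then have "indicator (B y) t = (indicator (B y) (x n i) :: real)"
        using xc that sub by (auto simp: indicator_def)
      then show "indicator (B y) t *\<^sub>R y = indicator (B y) (x n i) *\<^sub>R y" by simp
    qed
    then have "?I (\<lambda>t. indicator A t *\<^sub>R s' t) = ?I (\<lambda>t. indicator A t *\<^sub>R s' (x n i))"
      by (intro arg_cong[where f = ?I] ext) (auto simp: indicator_def)
    also have "\<dots> = measure M A *\<^sub>R s' (x n i)"
      by (rule simple_bochner_integral_indicator_scaleR[OF finite_measure_M A])
    finally have s'A: "?I (\<lambda>t. indicator A t *\<^sub>R s' t) = measure M A *\<^sub>R s' (x n i)" .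
    have "norm (\<nu> A - measure M A *\<^sub>R s' (x n i)) \<le> norm (\<nu> A - ?I (\<lambda>t. indicator A t *\<^sub>R s t)) +
        norm (?I (\<lambda>t. indicator A t *\<^sub>R s t) - ?I (\<lambda>t. indicator A t *\<^sub>R s' t))"
      unfolding s'A
      using norm_triangle_ineq[of "\<nu> A - ?I (\<lambda>t. indicator A t *\<^sub>R s t)"
          "?I (\<lambda>t. indicator A t *\<^sub>R s t) - measure M A *\<^sub>R s' (x n i)"] by simp
    then have "ennreal (norm (\<nu> A - measure M A *\<^sub>R s' (x n i))) \<le>
        ennreal (norm (\<nu> A - ?I (\<lambda>t. indicator A t *\<^sub>R s t))) +
        ennreal (norm (?I (\<lambda>t. indicator A t *\<^sub>R s t) - ?I (\<lambda>t. indicator A t *\<^sub>R s' t)))"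
      by (simp flip: ennreal_plus)
    also have "\<dots> \<le> (\<integral>\<^sup>+ t. h t * indicator A t \<partial>M) +
        (\<integral>\<^sup>+ t. ennreal (norm (indicator A t *\<^sub>R s t - indicator A t *\<^sub>R s' t)) \<partial>M)"
      using s s' by (intro add_mono hs A norm_simple_bochner_integral_diff_le
        finite_measure_M simple_function_scaleR_indicator)
    also have "(\<integral>\<^sup>+ t. ennreal (norm (indicator A t *\<^sub>R s t - indicator A t *\<^sub>R s' t)) \<partial>M) =
        (\<integral>\<^sup>+ t. ennreal (norm (s t - s' t)) * indicator A t \<partial>M)"
      by (intro nn_integral_cong) (auto simp: indicator_def)
    also have "(\<integral>\<^sup>+ t. h t * indicator A t \<partial>M) + \<dots> = (\<integral>\<^sup>+ t. h' t * indicator A t \<partial>M)"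
      unfolding h'_def distrib_right by (rule nn_integral_add[symmetric]) measurable
    finally show ?thesis .
  qed
  show ?thesis
    by (rule exI[of _ h'], rule exI[of _ n0]) (use h' h'e main in blast)
qed

text \<open>The level \<open>n\<close> is found before the points \<open>k i\<close> are chosen, so
  the bound applies to whatever points the next level offers, in particular to those of a
  fork.\<close>

lemma deviation_small:
  assumes rnp: "radon_nikodym_property TYPE('b)" and "0 < e"
  shows "\<exists>n. \<forall>k. (\<forall>i<N n. k i \<le> N (Suc n) \<and> x n i \<le> x (Suc n) (k i) \<and> x (Suc n) (k i) \<le> x n (Suc i)) \<longrightarrow>
    (\<Sum>i<N n. norm (v (Suc n) (k i) - v n i -
       ((x (Suc n) (k i) - x n i) / (x n (Suc i) - x n i)) *\<^sub>R (v n (Suc i) - v n i))) \<le> e"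
proof -
  obtain h n where h: "h \<in> borel_measurable M" "(\<integral>\<^sup>+ t. h t \<partial>M) \<le> ennreal (e / 2)"
    and "\<forall>i<N n. \<exists>r. \<forall>A\<in>sets M. A \<subseteq> cell n i \<longrightarrow>
       ennreal (norm (\<nu> A - measure M A *\<^sub>R r)) \<le> (\<integral>\<^sup>+ t. h t * indicator A t \<partial>M)"
    using cellwise_density[OF rnp half_gt_zero[OF \<open>0 < e\<close>]] by blast
  then obtain r where r: "\<And>i A. i < N n \<Longrightarrow> A \<in> sets M \<Longrightarrow> A \<subseteq> cell n i \<Longrightarrow>
       ennreal (norm (\<nu> A - measure M A *\<^sub>R r i)) \<le> (\<integral>\<^sup>+ t. h t * indicator A t \<partial>M)"
    by metis
  show ?thesis
  proof (intro exI[of _ n] allI impI)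
    fix k
    assume k: "\<forall>i<N n. k i \<le> N (Suc n) \<and> x n i \<le> x (Suc n) (k i) \<and> x (Suc n) (k i) \<le> x n (Suc i)"
    let ?d = "\<lambda>i. norm (v (Suc n) (k i) - v n i -
       ((x (Suc n) (k i) - x n i) / (x n (Suc i) - x n i)) *\<^sub>R (v n (Suc i) - v n i))"
    have d: "ennreal (?d i) \<le> 2 * (\<integral>\<^sup>+ t. h t * indicator (cell n i) t \<partial>M)" if i: "i < N n" for i
    proof -
      obtain j where j: "j \<le> N (Suc n)" "x (Suc n) j = x n i" "v (Suc n) j = v n i"
        using refine i less_imp_le by blast
      have ki: "k i \<le> N (Suc n)" "j \<le> k i"
        using k i j x_le_iff[of j "Suc n" "k i"] by auto
      define A where "A = {x (Suc n) j..<x (Suc n) (k i)}"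
      have "A \<in> alg (Suc n)" unfolding A_def using j ki by (intro interval_alg) auto
      then have A: "A \<in> sets M" by (rule alg_sets)
      have Ac: "A \<subseteq> cell n i" using k i j by (auto simp: A_def cell_def)
      have \<nu>A: "\<nu> A = v (Suc n) (k i) - v n i"
        unfolding A_def using \<nu>_interval[of j "k i" "Suc n"] j ki by simp
      have mA: "measure M A = x (Suc n) (k i) - x n i"
        unfolding A_def using measure_interval[of j "k i" "Suc n"] j ki by simp
      have \<nu>c: "\<nu> (cell n i) = v n (Suc i) - v n i"
        unfolding cell_def using \<nu>_interval[of i "Suc i" n] i by simp
      have mc: "measure M (cell n i) = x n (Suc i) - x n i"
        unfolding cell_def using measure_interval[of i "Suc i" n] i by simp
      define q where "q = measure M A / measure M (cell n i)"
      have pos: "0 < measure M (cell n i)" using step[OF i] mc by simp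
      have q: "0 \<le> q" "q \<le> 1" "q * measure M (cell n i) = measure M A"
        using pos M.finite_measure_mono[OF Ac cell_sets[OF i]] by (auto simp: q_def)
      \<comment> \<open>Since \<open>q\<close> times the measure of the cell is the measure of
        \<open>A\<close>, the multiples of \<open>r i\<close> cancel. Two errors are left, each at
        most the integral of \<open>h\<close> over the cell; this is why \<open>h\<close> was taken
        for \<open>e / 2\<close>.\<close>
      have "?d i = norm ((\<nu> A - measure M A *\<^sub>R r i) - q *\<^sub>R (\<nu> (cell n i) - measure M (cell n i) *\<^sub>R r i))"
        unfolding \<nu>A[symmetric] mA[symmetric] \<nu>c[symmetric] mc[symmetric] q_def[symmetric]
        by (simp add: scaleR_diff_right q(3))
      also have "\<dots> \<le> norm (\<nu> A - measure M A *\<^sub>R r i) + norm (q *\<^sub>R (\<nu> (cell n i) - measure M (cell n i) *\<^sub>R r i))"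
        by (rule norm_triangle_ineq4)
      also have "norm (q *\<^sub>R (\<nu> (cell n i) - measure M (cell n i) *\<^sub>R r i)) \<le>
          1 * norm (\<nu> (cell n i) - measure M (cell n i) *\<^sub>R r i)"
        unfolding norm_scaleR using q by (intro mult_right_mono) auto
      finally have "ennreal (?d i) \<le> ennreal (norm (\<nu> A - measure M A *\<^sub>R r i)) +
          ennreal (norm (\<nu> (cell n i) - measure M (cell n i) *\<^sub>R r i))"
        by (simp flip: ennreal_plus)
      also have "\<dots> \<le> (\<integral>\<^sup>+ t. h t * indicator A t \<partial>M) + (\<integral>\<^sup>+ t. h t * indicator (cell n i) t \<partial>M)"
        using A Ac i cell_sets by (intro add_mono r) auto
      also have "(\<integral>\<^sup>+ t. h t * indicator A t \<partial>M) \<le> (\<integral>\<^sup>+ t. h t * indicator (cell n i) t \<partial>M)"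
        using Ac by (intro nn_integral_mono) (auto simp: indicator_def)
      finally show ?thesis by (simp add: mult_2 add_right_mono)
    qed
    have "ennreal (\<Sum>i<N n. ?d i) = (\<Sum>i<N n. ennreal (?d i))"
      by (intro sum_ennreal[symmetric]) auto
    also have "\<dots> \<le> (\<Sum>i<N n. 2 * (\<integral>\<^sup>+ t. h t * indicator (cell n i) t \<partial>M))"
      using d by (intro sum_mono) auto
    also have "\<dots> = 2 * (\<Sum>i<N n. \<integral>\<^sup>+ t. h t * indicator (cell n i) t \<partial>M)"
      by (simp add: sum_distrib_left)
    also have "\<dots> \<le> 2 * ennreal (e / 2)"
      using sum_nn_integral_cell_le[OF h(1)] h(2) by (intro mult_left_mono) (auto intro: order_trans)
    also have "\<dots> = ennreal e"
      using \<open>0 < e\<close> by (simp add: mult_2 flip: ennreal_plus)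
    finally show "(\<Sum>i<N n. ?d i) \<le> e" using \<open>0 < e\<close> by (simp add: ennreal_le_iff)
  qed
qed

end


section \<open>Partitions and index embeddings\<close>

text \<open>The induction runs from the right, so that an appended point does not shift the indices
  already enumerated.\<close>

lemma nths_enumeration:
  "\<exists>h. strict_mono_on {..<length (nths z I)} h \<and>
     h ` {..<length (nths z I)} = {i. i < length z \<and> i \<in> I} \<and>
     (\<forall>i<length (nths z I). nths z I ! i = z ! h i)"
proof (induction z rule: rev_induct)
  case Nil
  then show ?case by (simp add: strict_mono_on_def)
next
  case (snoc a z)
  let ?n = "length (nths z I)"
  obtain h where h: "strict_mono_on {..<?n} h" "h ` {..<?n} = {i. i < length z \<and> i \<in> I}"
    "\<And>i. i < ?n \<Longrightarrow> nths z I ! i = z ! h i" using snoc by auto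
  have hl: "h i < length z" if "i < ?n" for i
    using h(2) that by (metis (no_types, lifting) imageI lessThan_iff mem_Collect_eq)
  show ?case
  proof (cases "length z \<in> I")
    case False
    then have "nths (z @ [a]) I = nths z I" by (simp add: nths_append nths_singleton)
    moreover have "{i. i < length (z @ [a]) \<and> i \<in> I} = {i. i < length z \<and> i \<in> I}"
      using False by (auto simp: less_Suc_eq)
    ultimately show ?thesis using h hl by (intro exI[of _ h]) (auto simp: nth_append)
  next
    case True
    then have n: "nths (z @ [a]) I = nths z I @ [a]" by (simp add: nths_append nths_singleton)
    define g where "g = h(?n := length z)"
    have "strict_mono_on {..<Suc ?n} g"
      using h(1) hl unfolding strict_mono_on_def g_def by (auto simp: less_Suc_eq)
    moreover have "g ` {..<Suc ?n} = insert (length z) (h ` {..<?n})"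
      unfolding lessThan_Suc image_insert by (auto simp: g_def)
    moreover have "{i. i < length (z @ [a]) \<and> i \<in> I} = insert (length z) {i. i < length z \<and> i \<in> I}"
      using True by auto
    moreover have "(z @ [a]) ! g i = nths (z @ [a]) I ! i" if "i < Suc ?n" for i
      using that hl h(3) by (auto simp: g_def n nth_append less_Suc_eq)
    ultimately show ?thesis using h(2) by (intro exI[of _ g]) (simp add: n)
  qed
qed

lemma nths_cong_nth:
  assumes "length y = length z" "\<And>i. i < length z \<Longrightarrow> i \<in> I \<Longrightarrow> y ! i = z ! i"
  shows "nths y I = nths z I"
  using assms
proof (induction z arbitrary: y rule: rev_induct)
  case (snoc a z)
  then obtain b y' where y: "y = y' @ [b]" by (metis append_is_Nil_conv length_0_conv neq_Nil_conv rev_exhaust)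
  have len: "length y' = length z" using snoc.prems y by simp
  have "y' ! i = z ! i" if "i < length z" "i \<in> I" for i
    using snoc.prems(2)[of i] that y len by (simp add: nth_append)
  moreover have "length z \<in> I \<Longrightarrow> b = a"
    using snoc.prems(2)[of "length z"] y len by (simp add: nth_append)
  ultimately show ?case using snoc.IH[of y'] y len by (simp add: nths_append nths_singleton)
qed simp

text \<open>An occurrence of \<open>w\<close> as a subsequence may use inner visits of
  \<open>z\<close> to the end points. Moving its first and last index to the ends of
  \<open>z\<close> preserves order and values; \<open>hd w \<noteq> last w\<close> keeps the two
  moves apart.\<close>

lemma subseq_index_embedding:
  assumes "subseq w z" "w \<noteq> []" "hd w = hd z" "last w = last z" "hd w \<noteq> last w"
  shows "\<exists>h. index_embedding w z h"
proof -
  obtain I where I: "w = nths z I" using assms(1) by (auto simp: subseq_conv_nths)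
  obtain h where h: "strict_mono_on {..<length w} h" "h ` {..<length w} = {i. i < length z \<and> i \<in> I}"
    "\<And>i. i < length w \<Longrightarrow> w ! i = z ! h i"
    using nths_enumeration[of z I] unfolding I by auto
  have z: "z \<noteq> []" using assms I by auto
  have len: "1 < length w"
    using assms(2,5) by (cases w) auto
  have hl: "h i < length z" if "i < length w" for i
    using h(2) that by (metis (no_types, lifting) imageI lessThan_iff mem_Collect_eq)
  have hless: "h i < h j" if "i < j" "j < length w" for i j
    using h(1) that by (auto simp: strict_mono_on_def)
  define g where "g i = (if i = 0 then 0 else if i = length w - 1 then length z - 1 else h i)" for i
  have "g i < g j" if "i < j" "j < length w" for i j
  proof -
    have "h i < h j" "h j < length z" using hless hl that by auto
    moreover have "j = length w - 1 \<or> j < length w - 1" using that by auto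
    moreover have "h j < h (length w - 1)" if "j < length w - 1"
      using hless that by auto
    moreover have "h (length w - 1) < length z" using hl len by auto
    ultimately show ?thesis using that by (auto simp: g_def)
  qed
  moreover have "z ! g i = w ! i" if "i < length w" for i
    using that h(3) assms(2-4) z by (auto simp: g_def hd_conv_nth last_conv_nth)
  ultimately have "index_embedding w z g"
    unfolding index_embedding_def strict_mono_on_def using len by (auto simp: g_def)
  then show ?thesis by blast
qed

lemma index_embedding_less:
  "index_embedding w z h \<Longrightarrow> i < j \<Longrightarrow> j < length w \<Longrightarrow> h i < h j"
  by (auto simp: index_embedding_def strict_mono_on_def)

lemma index_embedding_bound:
  assumes "index_embedding w z h" "z \<noteq> []" "i < length w"
  shows "h i < length z"
proof -
  have "h i \<le> h (length w - 1)"
    using index_embedding_less[OF assms(1), of i "length w - 1"] assms(3)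
    by (cases "i = length w - 1") (auto intro: less_imp_le)
  then show ?thesis using assms by (cases z) (auto simp: index_embedding_def)
qed

section \<open>Refined partitions\<close>

lemma sum_dist_pos:
  assumes "distinct_adj z" "a < b" "b < length z"
  shows "0 < (\<Sum>t = a..<b. dist (z ! t) (z ! Suc t))"
  using assms by (intro sum_pos) (auto simp: distinct_adj_conv_nth)

text \<open>At an index \<open>h i\<close> with \<open>0 < i\<close> the formulas for the two adjacent intervals agree,
  since \<open>z\<close> has no repeated adjacent points.\<close>

lemma ex_partition_refinement:
  assumes h: "index_embedding w z h" and "w \<noteq> []" "z \<noteq> []" "distinct_adj z"
  shows "\<exists>\<gamma>. length \<gamma> = length z \<and>
    (\<forall>i. Suc i < length w \<longrightarrow> (\<forall>s \<in> {h i..h (Suc i)}.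
           \<gamma> ! s = \<alpha> ! i + (\<alpha> ! Suc i - \<alpha> ! i) * (\<Sum>t = h i..<s. dist (z ! t) (z ! Suc t))
                               / (\<Sum>t = h i..<h (Suc i). dist (z ! t) (z ! Suc t))))"
proof -
  define F where "F i s = \<alpha> ! i + (\<alpha> ! Suc i - \<alpha> ! i) * (\<Sum>t = h i..<s. dist (z ! t) (z ! Suc t))
                               / (\<Sum>t = h i..<h (Suc i). dist (z ! t) (z ! Suc t))" for i s
  \<comment> \<open>The interval in which \<open>s\<close> lies; a common end point is assigned to
    the interval on its right.\<close>
  define m where "m s = Max {i. i < length w \<and> h i \<le> s}" for s
  define \<gamma> where "\<gamma> = map (\<lambda>s. F (m s) s) [0..<length z]"
  have m: "m s = i" if "i < length w" "h i \<le> s" "Suc i < length w \<Longrightarrow> s < h (Suc i)" for i s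
    unfolding m_def
  proof (rule Max_eqI)
    fix j assume j: "j \<in> {i. i < length w \<and> h i \<le> s}"
    show "j \<le> i"
    proof (rule ccontr)
      assume "\<not> j \<le> i"
      then have "Suc i \<le> j" by simp
      then have "h (Suc i) \<le> h j"
        using index_embedding_less[OF h, of "Suc i" j] j by (cases "Suc i = j") auto
      then show False using that j \<open>Suc i \<le> j\<close> by auto
    qed
  qed (use that in auto)
  have "\<gamma> ! s = F i s" if i: "Suc i < length w" and s: "s \<in> {h i..h (Suc i)}" for i s
  proof -
    have hl: "h (Suc i) < length z" using index_embedding_bound[OF h \<open>z \<noteq> []\<close> i] .
    then have \<gamma>s: "\<gamma> ! s = F (m s) s" using s by (simp add: \<gamma>_def)
    show ?thesis
    proof (cases "s = h (Suc i)")
      case False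
      then have "m s = i" using i s by (intro m) auto
      then show ?thesis using \<gamma>s by simp
    next
      case True
      \<comment> \<open>At a left end point the inner sum is empty, so the formula returns the old
        division point. At the last index no interval follows, but the terms without meaning only
        multiply or divide 0.\<close>
      have "m s = Suc i" using i True index_embedding_less[OF h, of "Suc i" "Suc (Suc i)"] by (intro m) auto
      then have "\<gamma> ! s = \<alpha> ! Suc i" using \<gamma>s True by (simp add: F_def)
      moreover have "F i s = \<alpha> ! Suc i"
        using True sum_dist_pos[OF \<open>distinct_adj z\<close> index_embedding_less[OF h lessI i] hl] by (simp add: F_def)
      ultimately show ?thesis by simp
    qed
  qed
  then show ?thesis unfolding F_def by (intro exI[of _ \<gamma>]) (auto simp: \<gamma>_def)
qed

text \<open>Every index but the last is a left end point, where the sum is empty; the last one is a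
  right end point, where the quotient of the sums is 1.\<close>

lemma partition_refinement_old_points:
  assumes h: "index_embedding w z h" and "z \<noteq> []" "distinct_adj z" "1 < length w"
    and \<gamma>: "\<And>i s. Suc i < length w \<Longrightarrow> s \<in> {h i..h (Suc i)} \<Longrightarrow>
           \<gamma> ! s = \<alpha> ! i + (\<alpha> ! Suc i - \<alpha> ! i) * (\<Sum>t = h i..<s. dist (z ! t) (z ! Suc t))
                               / (\<Sum>t = h i..<h (Suc i). dist (z ! t) (z ! Suc t))"
    and i: "i < length w"
  shows "\<gamma> ! h i = \<alpha> ! i"
proof (cases "Suc i < length w")
  case True
  then show ?thesis using \<gamma>[of i "h i"] index_embedding_less[OF h lessI True] by simp
next
  case False
  then obtain j where j: "i = Suc j" using \<open>1 < length w\<close> i by (cases i) auto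
  then show ?thesis
    using \<gamma>[of j "h i"] i index_embedding_less[OF h lessI, of j]
      sum_dist_pos[OF \<open>distinct_adj z\<close>, of "h j" "h (Suc j)"] index_embedding_bound[OF h \<open>z \<noteq> []\<close>, of "Suc j"]
    by simp
qed


section \<open>Marked geodesics\<close>

text \<open>The number \<open>\<delta>\<close> stands for the total separation
  \<open>c * dist u v\<close>. The geodesic that is being extended is not an argument; it is linked
  to the fork by a separate clause on \<open>common_points z z'\<close>.\<close>

definition fork :: "'a::metric_space list set \<Rightarrow> real \<Rightarrow> 'a list \<Rightarrow> 'a list \<Rightarrow> bool" where
  "fork marked \<delta> z z' \<longleftrightarrow> length z = length z' \<and> common_points z z' \<in> marked \<and>
     (\<forall>y. length y = length z \<longrightarrow> (\<forall>i < length z. y ! i = z ! i \<or> y ! i = z' ! i) \<longrightarrow> y \<in> marked) \<and>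
     (\<forall>i \<in> distinct_indices z z'.
             0 < i \<and> i - 1 \<in> common_indices z z' \<and> i + 1 \<in> common_indices z z' \<and>
             dist (z ! i) (z ! (i - 1)) / dist (z ! i) (z ! (i + 1)) =
             dist (z' ! i) (z ! (i - 1)) / dist (z' ! i) (z ! (i + 1))) \<and>
     (\<Sum>i \<in> distinct_indices z z'. dist (z ! i) (z' ! i)) \<ge> \<delta>"

text \<open>A fork prescribes the ratio of the distances to the two neighbours, while the refinement
  formula uses the first distance relative to their sum.\<close>

lemma ratio_of_sum:
  fixes a b :: real
  assumes "0 < a" "0 < b" "0 < a'" "0 < b'" "a / b = a' / b'"
  shows "a / (a + b) = a' / (a' + b')"
proof -
  have "a * b' = a' * b" using assms by (simp add: frac_eq_eq)
  then have "a * (a' + b') = a' * (a + b)" by (simp add: algebra_simps)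
  moreover have "a + b \<noteq> 0" "a' + b' \<noteq> 0" using assms by auto
  ultimately show ?thesis by (simp add: frac_eq_eq)
qed

locale marked_geodesics =
  fixes C :: real and u v :: "'a::metric_space" and marked :: "'a list set" and B :: real
  assumes uv: "u \<noteq> v" and geodesic: "w \<in> marked \<Longrightarrow> cuv_geodesic C u v w" and B: "1 \<le> B"
    and equivalent: "ws \<noteq> [] \<Longrightarrow> set ws \<subseteq> marked \<Longrightarrow> successively (cuv_extension C u v) ws \<Longrightarrow>
          nested_partition ws \<alpha> \<Longrightarrow> partition_equivalent B \<alpha> (geodesic_partition (last ws))"
begin

section \<open>Sequences of marked geodesics with their nested partitions\<close>

lemma marked_facts:
  assumes "w \<in> marked"
  shows "1 < length w" "w ! 0 = u" "w ! (length w - 1) = v" "distinct_adj w" "w \<noteq> []" "hd w = u" "last w = v"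
    "0 < chain_length w" "chain_length w \<le> C * dist u v"
proof -
  have g: "w \<noteq> []" "hd w = u" "last w = v" "distinct_adj w" "chain_length w \<le> C * dist u v"
    using geodesic[OF assms] by (auto simp: cuv_geodesic_def)
  show l: "1 < length w" using g uv by (cases w) auto
  show "w ! 0 = u" "w ! (length w - 1) = v" using g by (auto simp: hd_conv_nth last_conv_nth)
  have "w ! i \<noteq> w ! (i - 1)" if "i \<in> {1..<length w}" for i
    using g(4) that by (cases i) (auto simp: distinct_adj_conv_nth)
  then show "0 < chain_length w" unfolding chain_length_def using l by (intro sum_pos) auto
qed (use geodesic[OF assms] in \<open>auto simp: cuv_geodesic_def\<close>)

text \<open>Only the last geodesic and its partition matter for the geometry, but the whole sequence
  is carried along because condition 2 speaks of it.\<close>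

definition good :: "'a list list \<Rightarrow> real list \<Rightarrow> bool" where
  "good ws \<alpha> \<longleftrightarrow> ws \<noteq> [] \<and> set ws \<subseteq> marked \<and> successively (cuv_extension C u v) ws \<and> nested_partition ws \<alpha>"

lemma good_last: "good ws \<alpha> \<Longrightarrow> last ws \<in> marked"
  by (auto simp: good_def)

lemma nested_partition_ends:
  assumes "nested_partition ws \<alpha>" "set ws \<subseteq> marked"
  shows "ws \<noteq> [] \<and> length \<alpha> = length (last ws) \<and> \<alpha> ! 0 = 0 \<and> \<alpha> ! (length (last ws) - 1) = 1"
  using assms
proof induction
  case (first w)
  then have w: "w \<in> marked" by simp
  have "{Suc 0..length w - Suc 0} = {Suc 0..<length w}" using marked_facts(1)[OF w] by auto
  then show ?case
    using marked_facts[OF w] by (auto simp: geodesic_partition_def chain_length_def)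
next
  case (step ws \<alpha> z \<gamma>)
  let ?w = "last ws"
  have IH: "ws \<noteq> []" "\<alpha> ! 0 = 0" "\<alpha> ! (length ?w - 1) = 1" using step by auto
  have w: "?w \<in> marked" and z: "z \<in> marked" using step IH(1) by (auto intro: subsetD[OF _ last_in_set])
  obtain h where h: "index_embedding ?w z h" and \<gamma>: "length \<gamma> = length z"
    "\<And>i s. Suc i < length ?w \<Longrightarrow> s \<in> {h i..h (Suc i)} \<Longrightarrow>
           \<gamma> ! s = \<alpha> ! i + (\<alpha> ! Suc i - \<alpha> ! i) * (\<Sum>t = h i..<s. dist (z ! t) (z ! Suc t))
                               / (\<Sum>t = h i..<h (Suc i). dist (z ! t) (z ! Suc t))"
    using step.hyps(2) unfolding partition_refinement_def by blast
  note old = partition_refinement_old_points[OF h marked_facts(5,4)[OF z] marked_facts(1)[OF w] \<gamma>(2)]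
  have "\<gamma> ! h 0 = \<alpha> ! 0" "\<gamma> ! h (length ?w - 1) = \<alpha> ! (length ?w - 1)"
    using marked_facts(1)[OF w] by (auto intro!: old)
  then show ?case using h IH \<gamma>(1) by (simp add: index_embedding_def)
qed

lemma good_facts:
  assumes "good ws \<alpha>"
  shows "length \<alpha> = length (last ws)" "\<alpha> ! 0 = 0" "\<alpha> ! (length (last ws) - 1) = 1"
  using nested_partition_ends assms by (auto simp: good_def)

lemma geodesic_partition_diff:
  "Suc i < length w \<Longrightarrow> geodesic_partition w ! Suc i - geodesic_partition w ! i =
     dist (w ! Suc i) (w ! i) / chain_length w"
  by (simp add: geodesic_partition_def diff_divide_distrib[symmetric])

text \<open>Both claims come from the lower bound in condition 2: the fraction of length taken up by
  a step is at most \<open>B\<close> times the parameter increment. It is positive, and the total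
  length is at most \<open>C * dist u v\<close>.\<close>

lemma good_increments:
  assumes good: "good ws \<alpha>" and i: "Suc i < length (last ws)"
  shows "\<alpha> ! i < \<alpha> ! Suc i"
    and "dist (last ws ! Suc i) (last ws ! i) \<le> B * (C * dist u v) * (\<alpha> ! Suc i - \<alpha> ! i)"
proof -
  let ?w = "last ws" and ?d = "\<alpha> ! Suc i - \<alpha> ! i"
  note w = marked_facts[OF good_last[OF good]]
  let ?b = "dist (?w ! Suc i) (?w ! i) / chain_length ?w"
  have "1 / B \<le> ?d / (geodesic_partition ?w ! Suc i - geodesic_partition ?w ! i)"
    using equivalent[of ws \<alpha>] good good_facts(1)[OF good] i by (auto simp: good_def partition_equivalent_def)
  then have le: "1 / B \<le> ?d / ?b" using geodesic_partition_diff[OF i] by simp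
  have pos: "0 < dist (?w ! Suc i) (?w ! i)" using w(4) i by (auto simp: distinct_adj_conv_nth dist_commute)
  then have b: "0 < ?b" using w(8) by simp
  have "?b / B \<le> ?d" using le unfolding pos_le_divide_eq[OF b] by (simp add: mult.commute)
  moreover have "0 < ?b / B" by (rule divide_pos_pos[OF b]) (use B in simp)
  ultimately have d: "0 < ?d" by linarith
  then show "\<alpha> ! i < \<alpha> ! Suc i" by simp
  have "dist (?w ! Suc i) (?w ! i) \<le> B * chain_length ?w * ?d"
    using \<open>?b / B \<le> ?d\<close> w(8) B by (simp add: field_simps)
  also have "\<dots> \<le> B * (C * dist u v) * ?d"
    using w(9) d B by (intro mult_right_mono mult_left_mono) auto
  finally show "dist (?w ! Suc i) (?w ! i) \<le> B * (C * dist u v) * ?d" .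
qed

lemma good_mono:
  assumes "good ws \<alpha>" "i \<le> j" "j < length (last ws)"
  shows "\<alpha> ! i \<le> \<alpha> ! j"
  using assms(2,3)
proof (induction j rule: dec_induct)
  case (step j)
  then show ?case using good_increments(1)[OF assms(1), of j] by simp
qed simp

text \<open>The embedding \<open>h\<close> is left to the caller, since the refinement may be formed
  with any of them; for a fork it has to be the enumeration of the common indices.\<close>

lemma good_extend:
  assumes good: "good ws \<alpha>" and z: "z \<in> marked" "subseq (last ws) z"
    and h: "index_embedding (last ws) z h"
  shows "\<exists>\<gamma>. good (ws @ [z]) \<gamma> \<and> (\<forall>i<length (last ws). \<gamma> ! h i = \<alpha> ! i) \<and>
    (\<forall>i s. Suc i < length (last ws) \<longrightarrow> s \<in> {h i..h (Suc i)} \<longrightarrow>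
           \<gamma> ! s = \<alpha> ! i + (\<alpha> ! Suc i - \<alpha> ! i) * (\<Sum>t = h i..<s. dist (z ! t) (z ! Suc t))
                               / (\<Sum>t = h i..<h (Suc i). dist (z ! t) (z ! Suc t)))"
proof -
  let ?w = "last ws"
  note w = good_last[OF good]
  obtain \<gamma> where \<gamma>: "length \<gamma> = length z"
    "\<And>i s. Suc i < length (last ws) \<Longrightarrow> s \<in> {h i..h (Suc i)} \<Longrightarrow>
           \<gamma> ! s = \<alpha> ! i + (\<alpha> ! Suc i - \<alpha> ! i) * (\<Sum>t = h i..<s. dist (z ! t) (z ! Suc t))
                               / (\<Sum>t = h i..<h (Suc i). dist (z ! t) (z ! Suc t))"
    using ex_partition_refinement[OF h marked_facts(5)[OF w] marked_facts(5,4)[OF z(1)]] by blast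
  have "partition_refinement ?w \<alpha> z \<gamma>"
    unfolding partition_refinement_def using \<gamma> h by blast
  moreover have "cuv_extension C u v ?w z"
    using geodesic w z by (auto simp: cuv_extension_def)
  ultimately have "good (ws @ [z]) \<gamma>"
    using good z by (auto simp: good_def successively_append_iff intro: nested_partition.step)
  then show ?thesis
    using partition_refinement_old_points[OF h marked_facts(5,4)[OF z(1)] marked_facts(1)[OF w] \<gamma>(2)] \<gamma>(2)
    by (intro exI[of _ \<gamma>]) simp
qed

text \<open>The ratio condition makes the parameter of the new point between two common neighbours
  the same for both choices.  The values of \<open>f\<close> at the two choices are at distance at least
  \<open>l * dist (z ! j) (z' ! j)\<close>, so one of them deviates from the chord by half of that.\<close>

lemma fork_deviation:
  fixes f :: "'a \<Rightarrow> 'b::real_normed_vector"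
  assumes good: "good ws \<alpha>" and fork: "fork marked \<delta> z z'" and p: "last ws = common_points z z'"
    and f: "\<And>x y. l * dist x y \<le> norm (f x - f y)" and "0 \<le> l"
  obtains y \<gamma> h k where "good (ws @ [y]) \<gamma>"
    "\<And>i. i < length (last ws) \<Longrightarrow> h i < length y \<and> y ! h i = last ws ! i \<and> \<gamma> ! h i = \<alpha> ! i"
    "\<And>i. Suc i < length (last ws) \<Longrightarrow> h i \<le> k i \<and> k i \<le> h (Suc i)"
    "l / 2 * \<delta> \<le> (\<Sum>i<length (last ws) - 1. norm (f (y ! k i) - f (last ws ! i) -
       ((\<gamma> ! k i - \<alpha> ! i) / (\<alpha> ! Suc i - \<alpha> ! i)) *\<^sub>R (f (last ws ! Suc i) - f (last ws ! i))))"
proof -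
  define p where "p = last ws"
  define I where "I = common_indices z z'"
  define J where "J = distinct_indices z z'"
  have len: "length z' = length z" using fork by (simp add: fork_def)
  have mix: "\<And>y. length y = length z \<Longrightarrow> (\<And>i. i < length z \<Longrightarrow> y ! i = z ! i \<or> y ! i = z' ! i) \<Longrightarrow> y \<in> marked"
    using fork by (auto simp: fork_def)
  have z: "z \<in> marked" by (rule mix) auto
  have z': "z' \<in> marked" by (rule mix) (auto simp: len)
  note zf = marked_facts[OF z] and z'f = marked_facts[OF z']
  have I: "i \<in> I \<longleftrightarrow> i < length z \<and> z ! i = z' ! i" for i
    by (auto simp: I_def common_indices_def len)
  have J: "j \<in> J \<longleftrightarrow> j < length z \<and> z ! j \<noteq> z' ! j" for j
    by (auto simp: J_def distinct_indices_def len)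
  have J1: "0 < j" "j - 1 \<in> I" "Suc j \<in> I"
    "dist (z ! j) (z ! (j - 1)) / dist (z ! j) (z ! Suc j) = dist (z' ! j) (z ! (j - 1)) / dist (z' ! j) (z ! Suc j)"
    if "j \<in> J" for j
    using fork that unfolding fork_def I_def J_def by auto
  have finJ: "finite J" by (rule finite_subset[of _ "{..<length z}"]) (auto simp: J)
  have p_nths: "p = nths z I" using p by (simp add: common_points_def I_def p_def)
  have pm: "p \<in> marked" using good_last[OF good] by (simp add: p_def)
  note pf = marked_facts[OF pm]
  obtain h where h: "strict_mono_on {..<length p} h" "h ` {..<length p} = {i. i < length z \<and> i \<in> I}"
    "\<And>i. i < length p \<Longrightarrow> p ! i = z ! h i"
    using nths_enumeration[of z I] unfolding p_nths[symmetric] by auto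
  have hI: "h i \<in> I" if "i < length p" for i
    using h(2) that by blast
  have hz: "h i < length z" if "i < length p" for i
    using hI[OF that] I by blast
  have hless: "h i < h j \<longleftrightarrow> i < j" if "i < length p" "j < length p" for i j
    using strict_mono_on_less[OF h(1)] that by auto
  have hex: "\<exists>a<length p. h a = i" if "i \<in> I" for i
    using h(2) that I by (smt (verit) imageE lessThan_iff mem_Collect_eq)
  \<comment> \<open>Both geodesics run from \<open>u\<close> to \<open>v\<close>, so their end
    indices are common. Hence the enumeration of the common indices reaches both ends, as an index
    embedding must.\<close>
  have h0: "h 0 = 0"
  proof -
    have "0 \<in> I" using zf z'f unfolding I by auto
    then obtain a where a: "a < length p" "h a = 0" using hex by blast
    then show ?thesis using hless[of 0 a] pf(5) by (cases a) auto
  qed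
  have hlast: "h (length p - 1) = length z - 1"
  proof -
    have "length z - 1 \<in> I" using zf z'f len unfolding I by auto
    then obtain a where a: "a < length p" "h a = length z - 1" using hex by blast
    moreover have "h (length p - 1) < length z" using hz pf(1) by simp
    moreover have "a = length p - 1 \<or> a < length p - 1" using \<open>a < length p\<close> by linarith
    ultimately show ?thesis using hless[of a "length p - 1"] pf(1,5) by auto
  qed
  \<comment> \<open>The index \<open>j\<close> is not common but its neighbours are, so these are
    consecutive in the enumeration: each pair of distinct points sits alone in one interval of the
    old partition.\<close>
  have nb: "\<exists>i. Suc i < length p \<and> h i = j - 1 \<and> h (Suc i) = Suc j" if j: "j \<in> J" for j
  proof -
    obtain a where a: "a < length p" "h a = j - 1" using hex J1[OF j] by blast
    obtain b where b: "b < length p" "h b = Suc j" using hex J1[OF j] by blast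
    have "a < b" using hless[OF a(1) b(1)] a b J1(1)[OF j] by auto
    then have sa: "Suc a < length p" using b by simp
    have "h a < h (Suc a)" using hless[OF a(1) sa] by simp
    moreover have "h (Suc a) \<le> h b"
      using hless[OF sa b(1)] \<open>a < b\<close> by (cases "Suc a = b") (auto intro: less_imp_le)
    moreover have "h (Suc a) \<noteq> j" using hI[OF sa] j I J by auto
    ultimately show ?thesis using a b sa J1(1)[OF j] by (intro exI[of _ a]) auto
  qed
  then obtain idx where idx: "\<And>j. j \<in> J \<Longrightarrow> Suc (idx j) < length p"
    "\<And>j. j \<in> J \<Longrightarrow> h (idx j) = j - 1" "\<And>j. j \<in> J \<Longrightarrow> h (Suc (idx j)) = Suc j" by metis
  define t where "t j = dist (z ! j) (z ! (j - 1)) / (dist (z ! j) (z ! (j - 1)) + dist (z ! j) (z ! Suc j))" for j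
  define D where "D a j = norm (f a - f (z ! (j - 1)) - t j *\<^sub>R (f (z ! Suc j) - f (z ! (j - 1))))" for a j
  \<comment> \<open>At a common index the two alternatives coincide, so the test has an effect only
    at the indices in \<open>J\<close>.\<close>
  define y where "y = map (\<lambda>j. if l / 2 * dist (z ! j) (z' ! j) \<le> D (z ! j) j then z ! j else z' ! j) [0..<length z]"
  have ly: "length y = length z" by (simp add: y_def)
  have ychoice: "y ! i = z ! i \<or> y ! i = z' ! i" if "i < length z" for i
    using that by (simp add: y_def)
  have ym: "y \<in> marked" using ly ychoice by (rule mix)
  note yf = marked_facts[OF ym]
  have yI: "y ! i = z ! i" if "i \<in> I" for i
    using ychoice[of i] that I by auto
  have Dy: "l / 2 * dist (z ! j) (z' ! j) \<le> D (y ! j) j" if "j \<in> J" for j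
  proof (cases "l / 2 * dist (z ! j) (z' ! j) \<le> D (z ! j) j")
    case True
    then show ?thesis using that J by (simp add: y_def)
  next
    case False
    have "l * dist (z ! j) (z' ! j) \<le> norm (f (z ! j) - f (z' ! j))" by (rule f)
    also have "\<dots> \<le> D (z ! j) j + D (z' ! j) j"
      unfolding D_def
      using norm_triangle_ineq4[of "f (z ! j) - f (z ! (j - 1)) - t j *\<^sub>R (f (z ! Suc j) - f (z ! (j - 1)))"
        "f (z' ! j) - f (z ! (j - 1)) - t j *\<^sub>R (f (z ! Suc j) - f (z ! (j - 1)))"] by simp
    finally show ?thesis using False that J by (simp add: y_def)
  qed
  have emb: "index_embedding p y h"
    unfolding index_embedding_def using h(1) h0 hlast ly yI hI h(3) by auto
  have "nths y I = nths z I" by (rule nths_cong_nth) (auto simp: ly yI)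
  then have "subseq p y" unfolding p_nths subseq_conv_nths by metis
  then obtain \<gamma> where \<gamma>: "good (ws @ [y]) \<gamma>" "\<And>i. i < length p \<Longrightarrow> \<gamma> ! h i = \<alpha> ! i"
    "\<And>i s. Suc i < length p \<Longrightarrow> s \<in> {h i..h (Suc i)} \<Longrightarrow>
           \<gamma> ! s = \<alpha> ! i + (\<alpha> ! Suc i - \<alpha> ! i) * (\<Sum>t = h i..<s. dist (y ! t) (y ! Suc t))
                               / (\<Sum>t = h i..<h (Suc i). dist (y ! t) (y ! Suc t))"
    using good_extend[OF good ym] emb unfolding p_def by blast
  have ratio: "(\<gamma> ! j - \<alpha> ! idx j) / (\<alpha> ! Suc (idx j) - \<alpha> ! idx j) = t j" if j: "j \<in> J" for j
  proof -
    let ?i = "idx j"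
    note j1 = J1[OF j]
    have jl: "Suc j < length z" using j1 I by auto
    obtain m where m: "j = Suc m" using j1(1) by (cases j) auto
    have set: "{h ?i..<j} = {m}" "{h ?i..<h (Suc ?i)} = {m, j}"
      using idx[OF j] m by auto
    have "\<gamma> ! j = \<alpha> ! ?i + (\<alpha> ! Suc ?i - \<alpha> ! ?i) * dist (y ! m) (y ! j) / (dist (y ! m) (y ! j) + dist (y ! j) (y ! Suc j))"
      using \<gamma>(3)[of ?i j] idx[OF j] set m by simp
    moreover have "\<alpha> ! ?i < \<alpha> ! Suc ?i"
      using good_increments(1)[OF good] idx[OF j] by (simp add: p_def)
    ultimately have eq: "(\<gamma> ! j - \<alpha> ! ?i) / (\<alpha> ! Suc ?i - \<alpha> ! ?i) =
        dist (y ! j) (z ! (j - 1)) / (dist (y ! j) (z ! (j - 1)) + dist (y ! j) (z ! Suc j))"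
      using yI[OF j1(2)] yI[OF j1(3)] m by (simp add: dist_commute)
    have adj: "z ! m \<noteq> z ! j" "z ! j \<noteq> z ! Suc j" "z' ! m \<noteq> z' ! j" "z' ! j \<noteq> z' ! Suc j"
      using zf(4) z'f(4) jl m len by (simp_all add: distinct_adj_conv_nth)
    have pos: "0 < dist (z ! j) (z ! (j - 1))" "0 < dist (z ! j) (z ! Suc j)"
      "0 < dist (z' ! j) (z ! (j - 1))" "0 < dist (z' ! j) (z ! Suc j)"
      using adj m j1(2,3) I by auto
    show ?thesis
      using ychoice[of j] jl eq ratio_of_sum[OF pos j1(4)] by (auto simp: t_def)
  qed
  \<comment> \<open>An interval without a pair is represented by its left end point, where the
    deviation is 0.\<close>
  define k where "k i = (if Suc (h i) \<in> J then Suc (h i) else h i)" for i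
  have kb: "h i \<le> k i \<and> k i \<le> h (Suc i)" if "Suc i < length p" for i
    using hless[of i "Suc i"] that by (auto simp: k_def)
  have kidx: "k (idx j) = j" if "j \<in> J" for j
    using idx[OF that] J1[OF that] that by (auto simp: k_def)
  let ?E = "\<lambda>i. norm (f (y ! k i) - f (p ! i) -
       ((\<gamma> ! k i - \<alpha> ! i) / (\<alpha> ! Suc i - \<alpha> ! i)) *\<^sub>R (f (p ! Suc i) - f (p ! i)))"
  \<comment> \<open>Different pairs lie in different intervals, so no summand of the final sum is
    used twice.\<close>
  have inj: "inj_on idx J"
    by (rule inj_onI) (use kidx in metis)
  have "l / 2 * \<delta> \<le> l / 2 * (\<Sum>j\<in>J. dist (z ! j) (z' ! j))"
    using fork \<open>0 \<le> l\<close> by (intro mult_left_mono) (auto simp: fork_def J_def)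
  also have "\<dots> \<le> (\<Sum>j\<in>J. D (y ! j) j)"
    unfolding sum_distrib_left using Dy by (rule sum_mono)
  also have "\<dots> = (\<Sum>j\<in>J. ?E (idx j))"
  proof (rule sum.cong[OF refl])
    fix j assume j: "j \<in> J"
    have "p ! idx j = z ! (j - 1)" "p ! Suc (idx j) = z ! Suc j"
      using h(3)[of "idx j"] h(3)[of "Suc (idx j)"] idx[OF j] by auto
    then show "D (y ! j) j = ?E (idx j)"
      unfolding D_def kidx[OF j] ratio[OF j] by simp
  qed
  also have "\<dots> = (\<Sum>i\<in>idx ` J. ?E i)" using inj by (simp add: sum.reindex)
  also have "\<dots> \<le> (\<Sum>i<length p - 1. ?E i)"
    using idx(1) by (intro sum_mono2) (auto simp: less_diff_conv)
  finally have "l / 2 * \<delta> \<le> (\<Sum>i<length p - 1. ?E i)" .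
  moreover have "h i < length y \<and> y ! h i = p ! i \<and> \<gamma> ! h i = \<alpha> ! i" if "i < length p" for i
    using hz that ly yI hI h(3) \<gamma>(2) by auto
  ultimately show ?thesis
    using that[of y \<gamma> h k] \<gamma>(1) kb unfolding p_def by blast
qed

text \<open>Each step appends two geodesics: the mixture \<open>y\<close>, in which the deviation
  occurs, and the common points \<open>q\<close> of a fork over \<open>y\<close>, which make a
  further step possible. Level \<open>n\<close> of the result is the last geodesic after
  \<open>n\<close> such steps.\<close>

lemma fork_sequence:
  fixes f :: "'a \<Rightarrow> 'b::real_normed_vector"
  assumes ne: "marked \<noteq> {}"
    and forks: "\<forall>w\<in>marked. \<exists>z z'. fork marked \<delta> z z' \<and> subseq w (common_points z z')"
    and f: "\<And>x y. l * dist x y \<le> norm (f x - f y)" and "0 \<le> l"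
  shows "\<exists>(p :: nat \<Rightarrow> 'a list) (\<alpha> :: nat \<Rightarrow> real list) (k :: nat \<Rightarrow> nat \<Rightarrow> nat). \<forall>n.
    (\<exists>ws. good ws (\<alpha> n) \<and> last ws = p n) \<and>
    (\<forall>i<length (p n). \<exists>j<length (p (Suc n)). \<alpha> (Suc n) ! j = \<alpha> n ! i \<and> p (Suc n) ! j = p n ! i) \<and>
    (\<forall>i. Suc i < length (p n) \<longrightarrow> k n i < length (p (Suc n)) \<and>
       \<alpha> n ! i \<le> \<alpha> (Suc n) ! k n i \<and> \<alpha> (Suc n) ! k n i \<le> \<alpha> n ! Suc i) \<and>
    l / 2 * \<delta> \<le> (\<Sum>i<length (p n) - 1. norm (f (p (Suc n) ! k n i) - f (p n ! i) -
       ((\<alpha> (Suc n) ! k n i - \<alpha> n ! i) / (\<alpha> n ! Suc i - \<alpha> n ! i)) *\<^sub>R (f (p n ! Suc i) - f (p n ! i))))"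
proof -
  define P :: "nat \<Rightarrow> 'a list list \<times> real list \<Rightarrow> bool" where
    "P n s \<longleftrightarrow> good (fst s) (snd s) \<and> (\<exists>z z'. fork marked \<delta> z z' \<and> last (fst s) = common_points z z')" for n s
  define Q :: "nat \<Rightarrow> 'a list list \<times> real list \<Rightarrow> 'a list list \<times> real list \<Rightarrow> bool" where
    "Q n s s' \<longleftrightarrow> (let p = last (fst s); p' = last (fst s'); \<alpha> = snd s; \<alpha>' = snd s' in
      (\<forall>i<length p. \<exists>j<length p'. \<alpha>' ! j = \<alpha> ! i \<and> p' ! j = p ! i) \<and>
      (\<exists>k. (\<forall>i. Suc i < length p \<longrightarrow> k i < length p' \<and> \<alpha> ! i \<le> \<alpha>' ! k i \<and> \<alpha>' ! k i \<le> \<alpha> ! Suc i) \<and>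
        l / 2 * \<delta> \<le> (\<Sum>i<length p - 1. norm (f (p' ! k i) - f (p ! i) -
         ((\<alpha>' ! k i - \<alpha> ! i) / (\<alpha> ! Suc i - \<alpha> ! i)) *\<^sub>R (f (p ! Suc i) - f (p ! i))))))" for n s s'
  have "\<exists>s. P 0 s"
  \<comment> \<open>The first geodesic is already the common part of a fork, so the invariant holds
    from the start.\<close>
  proof -
    obtain w where "w \<in> marked" using ne by blast
    then obtain z z' where zz: "fork marked \<delta> z z'" using forks by blast
    then have "good [common_points z z'] (geodesic_partition (common_points z z'))"
      by (auto simp: good_def fork_def nested_partition.first)
    then show ?thesis using zz unfolding P_def
      by (intro exI[of _ "([common_points z z'], geodesic_partition (common_points z z'))"]) auto
  qed
  moreover have "\<exists>s'. P (Suc n) s' \<and> Q n s s'" if s: "P n s" for n s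
  proof -
    obtain ws \<alpha> where s_eq: "s = (ws, \<alpha>)" by (cases s)
    obtain z z' where good: "good ws \<alpha>" and zz: "fork marked \<delta> z z'" "last ws = common_points z z'"
      using s unfolding P_def s_eq by auto
    obtain y \<gamma> h k where y: "good (ws @ [y]) \<gamma>"
      and h: "\<And>i. i < length (last ws) \<Longrightarrow> h i < length y \<and> y ! h i = last ws ! i \<and> \<gamma> ! h i = \<alpha> ! i"
      and k: "\<And>i. Suc i < length (last ws) \<Longrightarrow> h i \<le> k i \<and> k i \<le> h (Suc i)"
      and dev: "l / 2 * \<delta> \<le> (\<Sum>i<length (last ws) - 1. norm (f (y ! k i) - f (last ws ! i) -
       ((\<gamma> ! k i - \<alpha> ! i) / (\<alpha> ! Suc i - \<alpha> ! i)) *\<^sub>R (f (last ws ! Suc i) - f (last ws ! i))))"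
      using fork_deviation[OF good zz f \<open>0 \<le> l\<close>] by blast
    have ym: "y \<in> marked" using good_last[OF y] by simp
    obtain x x' where xx: "fork marked \<delta> x x'" "subseq y (common_points x x')"
      using bspec[OF forks ym] by blast
    define q where "q = common_points x x'"
    have qm: "q \<in> marked" using xx by (simp add: fork_def q_def)
    note yf = marked_facts[OF ym] and qf = marked_facts[OF qm]
    obtain g where g: "index_embedding y q g"
      using subseq_index_embedding[of y q] xx(2) yf qf uv unfolding q_def by auto
    have "subseq (last (ws @ [y])) q" "index_embedding (last (ws @ [y])) q g"
      using xx(2) g by (simp_all add: q_def)
    from good_extend[OF y qm this] obtain \<epsilon> where "good ((ws @ [y]) @ [q]) \<epsilon>"
      "\<And>i. i < length (last (ws @ [y])) \<Longrightarrow> \<epsilon> ! g i = \<gamma> ! i" by blast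
    then have \<epsilon>: "good (ws @ [y] @ [q]) \<epsilon>" "\<And>i. i < length y \<Longrightarrow> \<epsilon> ! g i = \<gamma> ! i"
      by simp_all
    have gq: "g i < length q \<and> q ! g i = y ! i" if "i < length y" for i
      using index_embedding_bound[OF g qf(5)] g that by (auto simp: index_embedding_def)
    have kl: "k i < length y \<and> \<alpha> ! i \<le> \<gamma> ! k i \<and> \<gamma> ! k i \<le> \<alpha> ! Suc i" if "Suc i < length (last ws)" for i
      using h[of i] h[of "Suc i"] k[OF that] that good_mono[OF y, of "h i" "k i"]
        good_mono[OF y, of "k i" "h (Suc i)"] by auto
    have "P (Suc n) (ws @ [y] @ [q], \<epsilon>)"
      unfolding P_def using \<epsilon>(1) xx(1) by (auto simp: q_def)
    \<comment> \<open>The embedding \<open>g\<close> of \<open>y\<close> into \<open>q\<close>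
      preserves points and parameters, so the deviations found in \<open>y\<close> reappear in
      \<open>q\<close> at the indices \<open>g (k i)\<close>.\<close>
    moreover have "Q n s (ws @ [y] @ [q], \<epsilon>)"
      unfolding Q_def Let_def s_eq fst_conv snd_conv
    proof (intro conjI exI[of _ "\<lambda>i. g (k i)"] allI impI)
      fix i assume i: "i < length (last ws)"
      show "\<exists>j<length (last (ws @ [y] @ [q])). \<epsilon> ! j = \<alpha> ! i \<and> last (ws @ [y] @ [q]) ! j = last ws ! i"
        using h[OF i] gq[of "h i"] \<epsilon>(2)[of "h i"] by (intro exI[of _ "g (h i)"]) auto
    next
      fix i assume i: "Suc i < length (last ws)"
      show "g (k i) < length (last (ws @ [y] @ [q]))" "\<alpha> ! i \<le> \<epsilon> ! g (k i)" "\<epsilon> ! g (k i) \<le> \<alpha> ! Suc i"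
        using kl[OF i] gq[of "k i"] \<epsilon>(2)[of "k i"] by auto
    next
      show "l / 2 * \<delta> \<le> (\<Sum>i<length (last ws) - 1. norm (f (last (ws @ [y] @ [q]) ! g (k i)) - f (last ws ! i) -
         ((\<epsilon> ! g (k i) - \<alpha> ! i) / (\<alpha> ! Suc i - \<alpha> ! i)) *\<^sub>R (f (last ws ! Suc i) - f (last ws ! i))))"
      proof (rule order_trans[OF dev], rule eq_refl, rule sum.cong[OF refl])
        fix i assume "i \<in> {..<length (last ws) - 1}"
        then have "k i < length y" using kl[of i] by simp
        then show "norm (f (y ! k i) - f (last ws ! i) -
         ((\<gamma> ! k i - \<alpha> ! i) / (\<alpha> ! Suc i - \<alpha> ! i)) *\<^sub>R (f (last ws ! Suc i) - f (last ws ! i))) =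
          norm (f (last (ws @ [y] @ [q]) ! g (k i)) - f (last ws ! i) -
         ((\<epsilon> ! g (k i) - \<alpha> ! i) / (\<alpha> ! Suc i - \<alpha> ! i)) *\<^sub>R (f (last ws ! Suc i) - f (last ws ! i)))"
          using gq[of "k i"] \<epsilon>(2)[of "k i"] by simp
      qed
    qed
    ultimately show ?thesis by blast
  qed
  ultimately obtain S where S: "\<And>n. P n (S n)" "\<And>n. Q n (S n) (S (Suc n))"
    using dependent_nat_choice[of P Q] by metis
  define p where "p n = last (fst (S n))" for n
  define \<alpha> where "\<alpha> n = snd (S n)" for n
  have 1: "\<exists>ws. good ws (\<alpha> n) \<and> last ws = p n" for n
    using S(1)[of n] unfolding P_def p_def \<alpha>_def by blast
  have 2: "\<forall>i<length (p n). \<exists>j<length (p (Suc n)). \<alpha> (Suc n) ! j = \<alpha> n ! i \<and> p (Suc n) ! j = p n ! i" for n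
    using S(2)[of n] unfolding Q_def Let_def p_def \<alpha>_def by blast
  have "\<forall>n. \<exists>k. (\<forall>i. Suc i < length (p n) \<longrightarrow> k i < length (p (Suc n)) \<and>
       \<alpha> n ! i \<le> \<alpha> (Suc n) ! k i \<and> \<alpha> (Suc n) ! k i \<le> \<alpha> n ! Suc i) \<and>
     l / 2 * \<delta> \<le> (\<Sum>i<length (p n) - 1. norm (f (p (Suc n) ! k i) - f (p n ! i) -
       ((\<alpha> (Suc n) ! k i - \<alpha> n ! i) / (\<alpha> n ! Suc i - \<alpha> n ! i)) *\<^sub>R (f (p n ! Suc i) - f (p n ! i))))"
    using S(2) unfolding Q_def Let_def p_def \<alpha>_def by blast
  then obtain k where "\<forall>n. (\<forall>i. Suc i < length (p n) \<longrightarrow> k n i < length (p (Suc n)) \<and>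
       \<alpha> n ! i \<le> \<alpha> (Suc n) ! k n i \<and> \<alpha> (Suc n) ! k n i \<le> \<alpha> n ! Suc i) \<and>
     l / 2 * \<delta> \<le> (\<Sum>i<length (p n) - 1. norm (f (p (Suc n) ! k n i) - f (p n ! i) -
       ((\<alpha> (Suc n) ! k n i - \<alpha> n ! i) / (\<alpha> n ! Suc i - \<alpha> n ! i)) *\<^sub>R (f (p n ! Suc i) - f (p n ! i))))"
    unfolding choice_iff by blast
  with 1 2 show ?thesis by (intro exI[of _ p] exI[of _ \<alpha>] exI[of _ k]) simp
qed

text \<open>The two bounds on \<open>f\<close> have separate roles: \<open>l\<close> keeps the
  deviation from the chords large, and \<open>L\<close> bounds the slopes, so that the martingale
  has a dominated limit measure.\<close>

lemma no_bilipschitz_embedding: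
  fixes f :: "'a \<Rightarrow> 'b::banach"
  assumes ne: "marked \<noteq> {}" and "0 < \<delta>"
    and forks: "\<forall>w\<in>marked. \<exists>z z'. fork marked \<delta> z z' \<and> subseq w (common_points z z')"
    and rnp: "radon_nikodym_property TYPE('b)"
  shows "\<not> bilipschitz_embedding f"
proof
  assume "bilipschitz_embedding f"
  then obtain l L where l: "0 < l" "l \<le> L" and f: "\<And>x y. l * dist x y \<le> norm (f x - f y)"
    "\<And>x y. norm (f x - f y) \<le> L * dist x y"
    unfolding bilipschitz_embedding_def by blast
  from fork_sequence[OF ne forks f(1) less_imp_le[OF l(1)]] obtain p \<alpha> k where pk: "\<forall>n.
    (\<exists>ws. good ws (\<alpha> n) \<and> last ws = p n) \<and>
    (\<forall>i<length (p n). \<exists>j<length (p (Suc n)). \<alpha> (Suc n) ! j = \<alpha> n ! i \<and> p (Suc n) ! j = p n ! i) \<and>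
    (\<forall>i. Suc i < length (p n) \<longrightarrow> k n i < length (p (Suc n)) \<and>
       \<alpha> n ! i \<le> \<alpha> (Suc n) ! k n i \<and> \<alpha> (Suc n) ! k n i \<le> \<alpha> n ! Suc i) \<and>
    l / 2 * \<delta> \<le> (\<Sum>i<length (p n) - 1. norm (f (p (Suc n) ! k n i) - f (p n ! i) -
       ((\<alpha> (Suc n) ! k n i - \<alpha> n ! i) / (\<alpha> n ! Suc i - \<alpha> n ! i)) *\<^sub>R (f (p n ! Suc i) - f (p n ! i))))"
    by (elim exE) (rule that)
  note good = conjunct1[OF pk[rule_format]]
    and ref = conjunct1[OF conjunct2[OF pk[rule_format]], rule_format]
    and k = conjunct1[OF conjunct2[OF conjunct2[OF pk[rule_format]]], rule_format]
    and dev = conjunct2[OF conjunct2[OF conjunct2[OF pk[rule_format]]]]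
  have len: "1 < length (p n)" for n
    using good[of n] good_last marked_facts(1) by metis
  \<comment> \<open>A list of division points has one more entry than there are intervals. The slope
    bound is \<open>L\<close> times the bound for distance over parameter increment in
    \<open>good_increments\<close>.\<close>
  interpret divisions "\<lambda>n. length (p n) - 1" "\<lambda>n i. \<alpha> n ! i" "\<lambda>n i. f (p n ! i)" "L * (B * (C * dist u v))"
  proof
    fix n
    obtain ws where ws: "good ws (\<alpha> n)" "last ws = p n" using good by blast
    show "\<alpha> n ! 0 = 0" "\<alpha> n ! (length (p n) - 1) = 1"
      using good_facts[OF ws(1)] ws(2) by auto
    fix i
    show "\<alpha> n ! i < \<alpha> n ! Suc i" if "i < length (p n) - 1"
      using good_increments(1)[OF ws(1)] ws(2) that by simp
    show "\<exists>j\<le>length (p (Suc n)) - 1. \<alpha> (Suc n) ! j = \<alpha> n ! i \<and> f (p (Suc n) ! j) = f (p n ! i)"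
      if i: "i \<le> length (p n) - 1"
    proof -
      have "i < length (p n)" using i len[of n] by linarith
      from ref[OF this] obtain j where
        "j < length (p (Suc n))" "\<alpha> (Suc n) ! j = \<alpha> n ! i" "p (Suc n) ! j = p n ! i"
        by blast
      then show ?thesis by (intro exI[of _ j]) auto
    qed
    show "norm (f (p n ! Suc i) - f (p n ! i)) \<le> L * (B * (C * dist u v)) * (\<alpha> n ! Suc i - \<alpha> n ! i)"
      if "i < length (p n) - 1"
    proof -
      have "norm (f (p n ! Suc i) - f (p n ! i)) \<le> L * dist (p n ! Suc i) (p n ! i)" by (rule f)
      also have "\<dots> \<le> L * (B * (C * dist u v) * (\<alpha> n ! Suc i - \<alpha> n ! i))"
        using good_increments(2)[OF ws(1), of i] ws(2) that l by (intro mult_left_mono) auto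
      finally show ?thesis by (simp add: mult.assoc)
    qed
  qed
  \<comment> \<open>Half of the lower bound for the deviation is taken as \<open>e\<close>, so that
    the two estimates contradict each other.\<close>
  have "0 < l / 2 * \<delta> / 2" using l \<open>0 < \<delta>\<close> by simp
  from deviation_small[OF rnp this] obtain n where n: "\<And>k. (\<And>i. i < length (p n) - 1 \<Longrightarrow> k i \<le> length (p (Suc n)) - 1 \<and>
      \<alpha> n ! i \<le> \<alpha> (Suc n) ! k i \<and> \<alpha> (Suc n) ! k i \<le> \<alpha> n ! Suc i) \<Longrightarrow>
     (\<Sum>i<length (p n) - 1. norm (f (p (Suc n) ! k i) - f (p n ! i) -
       ((\<alpha> (Suc n) ! k i - \<alpha> n ! i) / (\<alpha> n ! Suc i - \<alpha> n ! i)) *\<^sub>R (f (p n ! Suc i) - f (p n ! i)))) \<le> l / 2 * \<delta> / 2"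
    by blast
  have "l / 2 * \<delta> \<le> l / 2 * \<delta> / 2"
  proof (rule order_trans[OF dev[of n]], rule n)
    fix i assume "i < length (p n) - 1"
    then have "Suc i < length (p n)" by simp
    from k[OF this] show "k n i \<le> length (p (Suc n)) - 1 \<and>
        \<alpha> n ! i \<le> \<alpha> (Suc n) ! k n i \<and> \<alpha> (Suc n) ! k n i \<le> \<alpha> n ! Suc i"
      by auto
  qed
  then show False using l \<open>0 < \<delta>\<close> by simp
qed

end

theorem theorem4p8:
  fixes C :: real
    and u v :: "'a::metric_space"
    and marked :: "'a list set"
  assumes "1 \<le> C"
    and "u \<noteq> v"
    and "marked \<noteq> {}"
    and "\<forall>w \<in> marked. cuv_geodesic C u v w"
    and cond1: "\<exists>c > 0. \<forall>w \<in> marked. \<exists>z z'.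
          z \<in> marked \<and> z' \<in> marked \<and> cuv_extension C u v w z \<and> cuv_extension C u v w z' \<and>
          z \<noteq> z' \<and> length z = length z' \<and>
          (\<forall>y. length y = length z \<longrightarrow> (\<forall>i < length z. y ! i = z ! i \<or> y ! i = z' ! i)
             \<longrightarrow> y \<in> marked) \<and>
          (\<exists>i \<in> common_indices z z'. z ! i \<notin> set w) \<and>
          (\<forall>i < length z. \<forall>j < length z'. z ! i = z' ! j \<longrightarrow> i = j) \<and>
          subseq w (common_points z z') \<and>
          common_points z z' \<in> marked \<and>
          distinct_indices z z' \<noteq> {} \<and>
          (\<forall>i \<in> distinct_indices z z'.
             0 < i \<and> i - 1 \<in> common_indices z z' \<and> i + 1 \<in> common_indices z z' \<and>
             dist (z ! i) (z ! (i - 1)) / dist (z ! i) (z ! (i + 1)) =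
             dist (z' ! i) (z ! (i - 1)) / dist (z' ! i) (z ! (i + 1))) \<and>
          (\<Sum>i \<in> distinct_indices z z'. dist (z ! i) (z' ! i)) \<ge> c * dist u v"
    and cond2: "\<exists>B \<ge> 1. \<forall>ws \<alpha>.
          ws \<noteq> [] \<longrightarrow> set ws \<subseteq> marked \<longrightarrow> successively (cuv_extension C u v) ws \<longrightarrow>
          nested_partition ws \<alpha> \<longrightarrow>
          partition_equivalent B \<alpha> (geodesic_partition (last ws))"
  shows "\<not> (radon_nikodym_property TYPE('b::banach) \<and>
             (\<exists>f :: 'a \<Rightarrow> 'b. bilipschitz_embedding f))"
proof -
  obtain B where B: "1 \<le> B" and equiv: "\<And>ws \<alpha>. ws \<noteq> [] \<Longrightarrow> set ws \<subseteq> marked \<Longrightarrow>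
      successively (cuv_extension C u v) ws \<Longrightarrow> nested_partition ws \<alpha> \<Longrightarrow>
      partition_equivalent B \<alpha> (geodesic_partition (last ws))"
    using cond2 by blast
  interpret marked_geodesics C u v marked B
    using assms(2,4) B equiv by unfold_locales auto
  \<comment> \<open>The separation is the same for all marked geodesics, which prevents the
    deviations from fading out along the sequence of forks.\<close>
  have "\<exists>c>0. \<forall>w\<in>marked. \<exists>z z'. fork marked (c * dist u v) z z' \<and> subseq w (common_points z z')"
    unfolding fork_def
    by (rule ex_forward[OF cond1])
      (elim conjE, rule conjI, assumption, rule ballI, drule (1) bspec, elim exE conjE,
        intro exI conjI, assumption+)
  then obtain c where "0 < c" and c: "\<forall>w\<in>marked. \<exists>z z'. fork marked (c * dist u v) z z' \<and>
      subseq w (common_points z z')" by blast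
  have "0 < c * dist u v" using \<open>0 < c\<close> assms(2) by simp
  then have "\<not> bilipschitz_embedding f" if "radon_nikodym_property TYPE('b)" for f :: "'a \<Rightarrow> 'b"
    using c that by (intro no_bilipschitz_embedding[OF assms(3)])
  then show ?thesis by blast
qed

end
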